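(* Let $G$ be a locally graded group and let $H\le \mathrm{Aut}(G)$ be a finite group of nil-automorphisms of $G$. Then $H$ is nilpotent.
   Context: A group $G$ is locally graded if every non-trivial finitely generated subgroup of $G$ has a proper normal subgroup of finite index. For $g\in G$ and $x\in\mathrm{Aut}(G)$, put $[g,x]=g^{-1}g^x$, $[g,_0x]=g$ and $[g,_kx]=[[g,_{k-1}x],x]$ for $k>0$. The automorphism $x$ is a nil-automorphism if for every $g\in G$ there is $n=n(g)$ with $[g,_nx]=1$. A group of nil-automorphisms of $G$ is a subgroup of $\mathrm{Aut}(G)$ all of whose elements are nil-automorphisms. *)

theory Defs
  imports "HOL-Algebra.Algebra"
begin

definition locally_graded :: "('a, 'b) monoid_scheme \<Rightarrow> bool" where
  "locally_graded G \<longleftrightarrow> group G \<and>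
     (\<forall>A. A \<subseteq> carrier G \<and> finite A \<and> generate G A \<noteq> {\<one>\<^bsub>G\<^esub>} \<longrightarrow>
        (\<exists>N. N \<lhd> G\<lparr>carrier := generate G A\<rparr> \<and> N \<noteq> generate G A \<and>
             finite (rcosets\<^bsub>G\<lparr>carrier := generate G A\<rparr>\<^esub> N)))"

(* [g,_n x]; the image g^x is x g. *)
primrec iter_comm :: "('a, 'b) monoid_scheme \<Rightarrow> 'a \<Rightarrow> nat \<Rightarrow> ('a \<Rightarrow> 'a) \<Rightarrow> 'a" where
  "iter_comm G g 0 x = g"
| "iter_comm G g (Suc n) x = inv\<^bsub>G\<^esub> (iter_comm G g n x) \<otimes>\<^bsub>G\<^esub> x (iter_comm G g n x)"

definition nil_automorphism :: "('a, 'b) monoid_scheme \<Rightarrow> ('a \<Rightarrow> 'a) \<Rightarrow> bool" where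
  "nil_automorphism G x \<longleftrightarrow>
     x \<in> auto G \<and> (\<forall>g\<in>carrier G. \<exists>n. iter_comm G g n x = \<one>\<^bsub>G\<^esub>)"

(* AutoGroup multiplies by f o g, which is the opposite of the product belonging to the
   exponent notation g^(xy) = (g^x)^y.  A set of automorphisms is a subgroup, and is nilpotent,
   for one product iff it is for the other. *)
definition group_of_nil_automorphisms ::
    "('a, 'b) monoid_scheme \<Rightarrow> ('a \<Rightarrow> 'a) set \<Rightarrow> bool" where
  "group_of_nil_automorphisms G H \<longleftrightarrow>
     subgroup H (AutoGroup G) \<and> (\<forall>x\<in>H. nil_automorphism G x)"

definition commutator_subgroup :: "('a, 'b) monoid_scheme \<Rightarrow> 'a set \<Rightarrow> 'a set \<Rightarrow> 'a set" where
  "commutator_subgroup G A B =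
     generate G {inv\<^bsub>G\<^esub> a \<otimes>\<^bsub>G\<^esub> inv\<^bsub>G\<^esub> b \<otimes>\<^bsub>G\<^esub> a \<otimes>\<^bsub>G\<^esub> b | a b. a \<in> A \<and> b \<in> B}"

(* The index is shifted: lower_central G n is the term usually written gamma_(n+1). *)
primrec lower_central :: "('a, 'b) monoid_scheme \<Rightarrow> nat \<Rightarrow> 'a set" where
  "lower_central G 0 = carrier G"
| "lower_central G (Suc n) = commutator_subgroup G (lower_central G n) (carrier G)"

definition nilpotent_group :: "('a, 'b) monoid_scheme \<Rightarrow> bool" where
  "nilpotent_group G \<longleftrightarrow> group G \<and> (\<exists>n. lower_central G n = {\<one>\<^bsub>G\<^esub>})"

end

theory Submission
  imports Defs
begin

text \<open>
  An automorphism \<open>x\<close> of \<open>G\<close>, viewed as a permutation of the underlying set, conjugates the left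
  translation by \<open>g\<close> to the left translation by \<open>x g\<close>. Inside the symmetric group on \<open>G\<close> the iterated
  commutators \<open>[g,\<^sub>n x]\<close> are therefore commutators of group elements, and the theorem becomes a statement
  about a finite subgroup \<open>H\<close> normalising a locally graded subgroup \<open>T\<close> and centralising it only trivially,
  such that every element of \<open>H\<close> is Engel on \<open>T\<close>. Commutators are formed with left conjugation:
  \<open>[g,x] = g\<^sup>- x g x\<^sup>-\<close>, where \<open>\<^sup>-\<close> denotes the inverse.

  The finite input is Baer's theorem, in the form that \<open>p\<close>-elements which are Engel on each other and form
  a conjugation-closed set generate a \<open>p\<close>-group (\<open>engel_p_elements_generate_p_group\<close>). It implies that in
  a finite group a subgroup \<open>R\<close> of elements Engel on a chief factor \<open>F\<close> with \<open>F R\<close> normal centralises \<open>F\<close>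
  (\<open>engel_subgroup_centralises_chief_factor\<close>), and hence Zorn's theorem that finite Engel groups are
  nilpotent. So it is enough to show that every \<open>y\<close> in \<open>H\<close> is Engel on \<open>H\<close> itself.

  Let \<open>R\<close> be minimal among the \<open>y\<close>-invariant subgroups of \<open>H\<close> that every sequence \<open>[g,\<^sub>n y]\<close> with \<open>g\<close> in \<open>H\<close>
  enters. Then \<open>R\<close> is generated by the commutators \<open>[x,y]\<close> with \<open>x\<close> in \<open>R\<close>, and the point is that such an
  \<open>R\<close> centralises \<open>T\<close>, so that \<open>R\<close> is trivial. Given \<open>h\<close> in \<open>T\<close> with \<open>[h,\<^sub>n y] = 1\<close>, induction on \<open>n\<close> allows
  one to assume that \<open>R\<close> centralises \<open>k = [h,y]\<close>. Then \<open>w = h\<^sup>- y h = k y\<close> acts on \<open>R\<close> in the same way as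
  \<open>y\<close>. The elements \<open>c x = (h\<^sup>- x h) x\<^sup>-\<close> with \<open>x\<close> in \<open>R\<close> generate a finitely generated subgroup \<open>L\<close> of \<open>T\<close>
  that is normalised by \<open>R\<close> and by \<open>w\<close>. If \<open>L\<close> is not trivial, local gradedness provides a finite chief
  factor \<open>F = L/E\<close> of the group \<open>L R \<langle>w\<rangle>\<close>. Both \<open>R\<close> and \<open>h\<^sup>- R h\<close> centralise \<open>F\<close>, by the chief factor
  theorem. Hence all \<open>c x\<close> do, so \<open>F\<close> is abelian and \<open>c\<close> induces a homomorphism from \<open>R\<close> to \<open>F\<close>. The Engel
  element \<open>w\<close> has a non-trivial fixed point in \<open>F\<close>, and as \<open>F\<close> is a chief factor \<open>w\<close> centralises \<open>F\<close> as well.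
  So the homomorphism takes the same value at \<open>x\<close> and at \<open>y x y\<^sup>-\<close>, kills the generators \<open>[x,y]\<close> of \<open>R\<close>, and
  is trivial; but its image generates \<open>F\<close>. This contradiction shows that \<open>L\<close> is trivial, which says that \<open>R\<close>
  centralises \<open>h\<close> (\<open>centralises_if_centralises_commutator\<close>).
\<close>

(* prime is to mean primality of numbers, not of elements of a monoid. *)
hide_const (open) Divisibility.prime

section \<open>Counting points moved by a p-group\<close>

text \<open>
  Asked of a set rather than of a subgroup, so that it applies to conjugacy classes as well.
\<close>

definition p_set :: "('a, 'b) monoid_scheme \<Rightarrow> nat \<Rightarrow> 'a set \<Rightarrow> bool" where
  "p_set G p A \<longleftrightarrow> (\<forall>a\<in>A. \<exists>k. a [^]\<^bsub>G\<^esub> (p ^ k) = \<one>\<^bsub>G\<^esub>)"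

lemma power_of_only_prime_factor:
  fixes n p :: nat
  assumes "n > 0" "\<And>q. prime q \<Longrightarrow> q dvd n \<Longrightarrow> q = p"
  shows "\<exists>k. n = p ^ k"
  using assms
proof (induction n rule: less_induct)
  case (less n)
  show ?case
  proof (cases "n = 1")
    case True
    then show ?thesis by (metis power_0)
  next
    case False
    then obtain q where q: "prime q" "q dvd n" using prime_factor_nat by blast
    then obtain m where m: "n = p * m" using less.prems(2) by blast
    have "prime p" using less.prems(2) q by blast
    then have "m < n" "m > 0" using m less.prems(1) prime_gt_1_nat by auto
    then obtain k where "m = p ^ k" using less.IH less.prems(2) m by (metis dvd_mult)
    then show ?thesis using m by (metis power_Suc)
  qed
qed

text \<open>
  If a prime \<open>q\<close> divides the order, Sylow's theorem gives a subgroup of order \<open>q\<close>, and a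
  non-trivial element of it has order dividing both \<open>q\<close> and a power of \<open>p\<close>.
\<close>

lemma (in group) order_prime_power:
  assumes fin: "finite (carrier G)" and p: "prime p" and P: "p_set G p (carrier G)"
  shows "\<exists>n. order G = p ^ n"
proof -
  have "q = p" if q: "prime q" "q dvd order G" for q
  proof -
    obtain m where m: "order G = q ^ 1 * m" using q(2) by auto
    then obtain H where H: "subgroup H G" "card H = q"
      using sylow_thm[OF q(1) group_axioms m fin] by auto
    then have "1 < card H" using q(1) prime_gt_1_nat by blast
    then obtain x where x: "x \<in> H" "x \<noteq> \<one>"
      by (metis H(1) card_1_singleton_iff less_irrefl One_nat_def is_singletonI' is_singleton_altdef
          singletonI subgroup.one_closed empty_iff)
    have xc: "x \<in> carrier G" using x H by (meson subgroup.mem_carrier)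
    have "ord x dvd q"
    proof -
      interpret K: group "G\<lparr>carrier := H\<rparr>" using H(1) subgroup_imp_group by blast
      have "x [^]\<^bsub>G\<lparr>carrier := H\<rparr>\<^esub> order (G\<lparr>carrier := H\<rparr>) = \<one>"
        using K.pow_order_eq_1[of x] x by simp
      then have "x [^] q = \<one>" using H(2) by (simp add: order_def nat_pow_consistent[symmetric])
      then show ?thesis using pow_eq_id[OF xc] by simp
    qed
    moreover obtain k where "x [^] (p ^ k) = \<one>" using P xc by (auto simp: p_set_def)
    then have "ord x dvd p ^ k" using pow_eq_id[OF xc] by simp
    ultimately have "ord x dvd gcd q (p ^ k)" by simp
    moreover have "ord x \<noteq> 1" using x(2) xc ord_eq_1 by blast
    ultimately have "\<not> coprime q (p ^ k)" by (metis coprime_iff_gcd_eq_1 dvd_1_iff_1 One_nat_def)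
    then show "q = p" using p q(1) by (metis coprime_power_right_iff primes_coprime)
  qed
  moreover have "order G > 0" using fin order_gt_0_iff_finite by blast
  ultimately show ?thesis using power_of_only_prime_factor by blast
qed

text \<open>
  The permutations of \<open>E\<close> that occur form a finite \<open>p\<close>-group, so all orbits have \<open>p\<close>-power length, and
  the moved points are the union of the orbits with more than one point. The \<open>p\<close>-power condition is put
  on the permutations because later the acting group has elements of order prime to \<open>p\<close> that
  act trivially.
\<close>

lemma (in group) p_action_moved_points:
  fixes act :: "'a \<Rightarrow> 'c \<Rightarrow> 'c"
  assumes p: "prime p" and fin: "finite E"
    and closed: "\<And>g x. g \<in> carrier G \<Longrightarrow> x \<in> E \<Longrightarrow> act g x \<in> E"
    and one: "\<And>x. x \<in> E \<Longrightarrow> act \<one> x = x"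
    and mult: "\<And>g h x. g \<in> carrier G \<Longrightarrow> h \<in> carrier G \<Longrightarrow> x \<in> E \<Longrightarrow> act (g \<otimes> h) x = act g (act h x)"
    and P: "\<And>g. g \<in> carrier G \<Longrightarrow> \<exists>k. \<forall>x\<in>E. act (g [^] (p ^ k)) x = x"
  shows "p dvd card {x \<in> E. \<exists>g\<in>carrier G. act g x \<noteq> x}"
proof -
  define \<phi> where "\<phi> g = restrict (act g) E" for g
  let ?B = "BijGroup E"
  interpret B: group ?B by (rule group_BijGroup)
  have inv1: "act (inv g) (act g x) = x" "act g (act (inv g) x) = x" if "g \<in> carrier G" "x \<in> E" for g x
    using that by (simp_all flip: mult add: one)
  have bij: "\<phi> g \<in> Bij E" if "g \<in> carrier G" for g
  proof -
    have "bij_betw (act g) E E"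
      using that by (intro bij_betwI[of _ _ _ "act (inv g)"]) (auto simp: closed inv1)
    then show ?thesis unfolding \<phi>_def Bij_def by auto
  qed
  have hom: "\<phi> \<in> hom G ?B"
  proof (rule homI)
    fix g h assume gh: "g \<in> carrier G" "h \<in> carrier G"
    show "\<phi> (g \<otimes> h) = \<phi> g \<otimes>\<^bsub>?B\<^esub> \<phi> h"
      using gh bij by (auto simp: BijGroup_def \<phi>_def compose_def mult closed fun_eq_iff)
  qed (simp add: bij BijGroup_def)
  interpret \<phi>: group_hom G ?B \<phi>
    using hom by unfold_locales
  define I where "I = \<phi> ` carrier G"
  define K where "K = ?B\<lparr>carrier := I\<rparr>"
  have I: "subgroup I ?B" unfolding I_def by (rule \<phi>.subgroup_img_is_subgroup[OF subgroup_self])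
  interpret K: group K unfolding K_def using I by (rule B.subgroup_imp_group)
  have "Bij E \<subseteq> E \<rightarrow>\<^sub>E E" by (auto simp: Bij_def PiE_def bij_betw_def)
  then have "finite (Bij E)" using fin finite_PiE[of E "\<lambda>_. E"] finite_subset by blast
  then have finK: "finite (carrier K)"
    using I finite_subset[of I "Bij E"] unfolding K_def by (auto simp: BijGroup_def dest: subgroup.subset)
  have "p_set K p (carrier K)"
  proof -
    have "\<exists>k. \<phi> g [^]\<^bsub>K\<^esub> (p ^ k) = \<one>\<^bsub>K\<^esub>" if g: "g \<in> carrier G" for g
    proof -
      obtain k where k: "\<forall>x\<in>E. act (g [^] (p ^ k)) x = x" using P[OF g] by blast
      have "\<phi> g [^]\<^bsub>K\<^esub> (p ^ k) = \<phi> g [^]\<^bsub>?B\<^esub> (p ^ k)"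
        unfolding K_def by (simp add: nat_pow_def)
      also have "\<dots> = \<phi> (g [^] (p ^ k))" using g by (simp add: \<phi>.hom_nat_pow)
      also have "\<dots> = \<one>\<^bsub>K\<^esub>" using k unfolding K_def \<phi>_def by (auto simp: BijGroup_def fun_eq_iff)
      finally show ?thesis by blast
    qed
    then show ?thesis unfolding p_set_def by (auto simp: K_def I_def)
  qed
  then obtain n where n: "order K = p ^ n" using K.order_prime_power[OF finK p] by blast
  interpret A: group_action K E "\<lambda>f. f"
  proof
    show "(\<lambda>f. f) \<in> hom K ?B" using I unfolding K_def by (auto simp: hom_def dest: subgroup.mem_carrier)
  qed
  let ?O = "orbits K E (\<lambda>f. f)"
  let ?M = "{x \<in> E. \<exists>g\<in>carrier G. act g x \<noteq> x}"
  have orb: "orbit K (\<lambda>f. f) x = {act g x | g. g \<in> carrier G}" if "x \<in> E" for x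
    using that by (simp add: orbit_def K_def I_def \<phi>_def Setcompr_eq_image image_image)
  have dvd: "p dvd card C" if C: "C \<in> ?O" "C \<subseteq> ?M" for C
  proof -
    obtain x where x: "x \<in> E" "C = orbit K (\<lambda>f. f) x" using C(1) by (auto simp: orbits_def)
    have "card C * card (stabilizer K (\<lambda>f. f) x) = p ^ n"
      using A.orbit_stabilizer_theorem[OF x(1)] x n by simp
    then have "card C dvd p ^ n" by (metis dvd_triv_left)
    then obtain i where i: "card C = p ^ i" using divides_primepow_nat[OF p] by blast
    have xX: "x \<in> C" using A.orbit_refl x by blast
    then obtain g where g: "g \<in> carrier G" "act g x \<noteq> x" using C by blast
    have "act g x \<in> C" using orb x g by blast
    then have "card C \<noteq> 1" using xX g(2) by (metis card_1_singletonE singletonD)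
    then show ?thesis using i by (cases i) auto
  qed
  have cover: "?M = \<Union>{C \<in> ?O. C \<subseteq> ?M}"
  proof
    show "?M \<subseteq> \<Union>{C \<in> ?O. C \<subseteq> ?M}"
    proof
      fix x assume x: "x \<in> ?M"
      then obtain g where g: "g \<in> carrier G" "act g x \<noteq> x" "x \<in> E" by blast
      have "\<exists>k\<in>carrier G. act k (act h x) \<noteq> act h x" if h: "h \<in> carrier G" for h
      proof (rule ccontr)
        assume "\<not> ?thesis"
        then have "act (h \<otimes> g \<otimes> inv h) (act h x) = act h x" using g h by blast
        then have "act h (act g x) = act h x" using g h by (simp flip: mult add: m_assoc)
        then have "act g x = x" using inv1(1)[OF h] g closed by metis
        then show False using g by simp
      qed
      then have "orbit K (\<lambda>f. f) x \<subseteq> ?M" using orb g closed by auto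
      moreover have "orbit K (\<lambda>f. f) x \<in> ?O" using g by (auto simp: orbits_def)
      ultimately show "x \<in> \<Union>{C \<in> ?O. C \<subseteq> ?M}" using A.orbit_refl g by blast
    qed
  qed blast
  have "p dvd card (\<Union>{C \<in> ?O. C \<subseteq> ?M})"
  proof (rule dvd_partition)
    show "finite (\<Union>{C \<in> ?O. C \<subseteq> ?M})" using cover fin by (metis (no_types, lifting) finite_subset mem_Collect_eq subsetI)
  qed (use dvd A.disjoint_union in auto)
  then show ?thesis using cover by simp
qed

section \<open>Conjugation, normalisers and products of p-subgroups\<close>

text \<open>
  Conjugation from the left: in a group of permutations multiplied by composition, this is the side on
  which conjugating a translation by an automorphism applies the automorphism.
\<close>

abbreviation conj_by :: "('a, 'b) monoid_scheme \<Rightarrow> 'a \<Rightarrow> 'a \<Rightarrow> 'a" where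
  "conj_by G x \<equiv> \<lambda>g. x \<otimes>\<^bsub>G\<^esub> g \<otimes>\<^bsub>G\<^esub> inv\<^bsub>G\<^esub> x"

lemma (in group) inv_mult_cancel:
  assumes "a \<in> carrier G" "b \<in> carrier G"
  shows "inv a \<otimes> (a \<otimes> b) = b" and "a \<otimes> (inv a \<otimes> b) = b"
  using assms by (simp_all flip: m_assoc)

lemmas (in group) word_simps = m_assoc inv_mult_group inv_mult_cancel

text \<open>
  Equality of sets, instead of an inclusion, makes this a subgroup also when \<open>A\<close> is infinite.
\<close>

definition normaliser :: "('a, 'b) monoid_scheme \<Rightarrow> 'a set \<Rightarrow> 'a set" where
  "normaliser G A = {x \<in> carrier G. conj_by G x ` A = A}"

lemma p_set_subset: "p_set G p A \<Longrightarrow> B \<subseteq> A \<Longrightarrow> p_set G p B"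
  by (auto simp: p_set_def)

context group
begin

lemma conj_by_hom: "x \<in> carrier G \<Longrightarrow> conj_by G x \<in> hom G G"
  by (rule homI) (simp_all add: word_simps)

lemma conj_by_conj_by:
  "x \<in> carrier G \<Longrightarrow> y \<in> carrier G \<Longrightarrow> g \<in> carrier G \<Longrightarrow>
    conj_by G x (conj_by G y g) = conj_by G (x \<otimes> y) g"
  by (simp add: word_simps)

lemma conj_by_image_image:
  assumes "x \<in> carrier G" "y \<in> carrier G" "A \<subseteq> carrier G"
  shows "conj_by G x ` conj_by G y ` A = conj_by G (x \<otimes> y) ` A"
  unfolding image_image using assms by (intro image_cong) (auto simp: conj_by_conj_by)

lemma conj_by_one_image: "A \<subseteq> carrier G \<Longrightarrow> conj_by G \<one> ` A = A"
  by (force simp: image_iff)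

lemma conj_by_pow:
  assumes "x \<in> carrier G" "g \<in> carrier G"
  shows "conj_by G x g [^] (n::nat) = conj_by G x (g [^] n)"
  using assms by (induction n) (simp_all add: word_simps)

lemma conj_by_inj: "x \<in> carrier G \<Longrightarrow> inj_on (conj_by G x) (carrier G)"
  by (rule inj_onI) simp

lemma normaliser_subgroup:
  assumes "A \<subseteq> carrier G"
  shows "subgroup (normaliser G A) G"
proof
  fix x y assume xy: "x \<in> normaliser G A" "y \<in> normaliser G A"
  then show "x \<otimes> y \<in> normaliser G A"
    using assms conj_by_image_image[of x y A] by (auto simp: normaliser_def)
next
  show "\<one> \<in> normaliser G A" using assms conj_by_one_image by (auto simp: normaliser_def)
next
  fix x assume x: "x \<in> normaliser G A"
  then have "conj_by G (inv x) ` A = conj_by G (inv x) ` conj_by G x ` A"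
    by (simp add: normaliser_def)
  also have "\<dots> = A" using x assms conj_by_image_image[of "inv x" x A] conj_by_one_image
    by (auto simp: normaliser_def)
  finally show "inv x \<in> normaliser G A" using x by (auto simp: normaliser_def)
qed (auto simp: normaliser_def)

lemma normaliser_conj_closed: "x \<in> normaliser G A \<Longrightarrow> a \<in> A \<Longrightarrow> conj_by G x a \<in> A"
  by (auto simp: normaliser_def)

lemma normaliser_inv_conj_closed:
  assumes "x \<in> normaliser G A" "a \<in> A" "A \<subseteq> carrier G"
  shows "inv x \<otimes> a \<otimes> x \<in> A"
proof -
  have "inv x \<in> normaliser G A" using assms normaliser_subgroup subgroup.m_inv_closed by metis
  moreover have "x \<in> carrier G" using assms by (simp add: normaliser_def)
  ultimately show ?thesis using normaliser_conj_closed[of "inv x" A a] assms by simp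
qed

text \<open>
  Since \<open>x\<close> has finite order, its inverse is a power of \<open>x\<close>; so the inclusion is an equality.
\<close>

lemma torsion_in_normaliser:
  assumes x: "x \<in> carrier G" "x [^] (n::nat) = \<one>" "n > 0" and A: "A \<subseteq> carrier G"
    and sub: "\<And>a. a \<in> A \<Longrightarrow> conj_by G x a \<in> A"
  shows "x \<in> normaliser G A"
proof -
  have pow: "conj_by G (x [^] k) a \<in> A" if "a \<in> A" for a and k :: nat
  proof (induction k)
    case (Suc k)
    have "conj_by G (x [^] Suc k) a = conj_by G x (conj_by G (x [^] k) a)"
      using that x A nat_pow_Suc2[OF x(1), of k] conj_by_conj_by[of x "x [^] k" a] by auto
    then show ?case using sub[OF Suc] by simp
  qed (use that A in auto)
  have "a \<in> conj_by G x ` A" if "a \<in> A" for a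
  proof -
    obtain m where m: "n = Suc m" using x(3) gr0_implies_Suc by blast
    have "conj_by G x (conj_by G (x [^] m) a) = conj_by G (x [^] n) a"
      using that x A m nat_pow_Suc2[OF x(1), of m] conj_by_conj_by[of x "x [^] m" a] by auto
    then have "a = conj_by G x (conj_by G (x [^] m) a)" using that x A by auto
    then show ?thesis using pow that by blast
  qed
  then show ?thesis using x sub by (auto simp: normaliser_def)
qed

lemma normaliser_generate:
  assumes A: "A \<subseteq> carrier G" shows "normaliser G A \<subseteq> normaliser G (generate G A)"
proof
  fix x assume x: "x \<in> normaliser G A"
  then have xc: "x \<in> carrier G" by (simp add: normaliser_def)
  interpret group_hom G G "conj_by G x" using conj_by_hom[OF xc] by unfold_locales
  show "x \<in> normaliser G (generate G A)"
    using generate_img[OF A] x xc by (simp add: normaliser_def)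
qed

lemma set_mult_subgroup:
  assumes U: "subgroup U G" and V: "subgroup V G" and N: "V \<subseteq> normaliser G U"
  shows "subgroup (U <#> V) G"
proof -
  note mc = subgroup.mem_carrier[OF U] subgroup.mem_carrier[OF V]
  have c: "v \<otimes> u \<otimes> inv v \<in> U" if "u \<in> U" "v \<in> V" for u v
    using N that normaliser_conj_closed by blast
  show ?thesis
  proof
    show "U <#> V \<subseteq> carrier G" using set_mult_closed mc by blast
  next
    fix a b assume "a \<in> U <#> V" "b \<in> U <#> V"
    then obtain u v u' v' where *: "u \<in> U" "v \<in> V" "u' \<in> U" "v' \<in> V" "a = u \<otimes> v" "b = u' \<otimes> v'"
      by (auto simp: set_mult_def)
    then have "a \<otimes> b = (u \<otimes> (v \<otimes> u' \<otimes> inv v)) \<otimes> (v \<otimes> v')" by (simp add: word_simps mc)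
    moreover have "u \<otimes> (v \<otimes> u' \<otimes> inv v) \<in> U" "v \<otimes> v' \<in> V"
      using * c U V by (simp_all add: subgroup.m_closed)
    ultimately show "a \<otimes> b \<in> U <#> V" by (auto simp: set_mult_def)
  next
    show "\<one> \<in> U <#> V" using subgroup.one_closed[OF U] subgroup.one_closed[OF V]
      by (force simp: set_mult_def)
  next
    fix a assume "a \<in> U <#> V"
    then obtain u v where *: "u \<in> U" "v \<in> V" "a = u \<otimes> v" by (auto simp: set_mult_def)
    then have "inv a = (inv v \<otimes> inv u \<otimes> inv (inv v)) \<otimes> inv v" by (simp add: word_simps mc)
    moreover have "inv v \<otimes> inv u \<otimes> inv (inv v) \<in> U" "inv v \<in> V"
      using * c U V by (simp_all only: subgroup.m_inv_closed)
    ultimately show "inv a \<in> U <#> V" by (auto simp: set_mult_def)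
  qed
qed

text \<open>
  Modulo \<open>U\<close> the element \<open>u v\<close> is \<open>v\<close>.
\<close>

lemma set_mult_pow:
  assumes U: "subgroup U G" and V: "subgroup V G" and N: "V \<subseteq> normaliser G U"
    and uv: "u \<in> U" "v \<in> V"
  shows "\<exists>u'\<in>U. (u \<otimes> v) [^] (n::nat) = u' \<otimes> v [^] n"
proof (induction n)
  case 0
  show ?case using subgroup.one_closed[OF U] by force
next
  case (Suc n)
  note mc = subgroup.mem_carrier[OF U] subgroup.mem_carrier[OF V]
  obtain u' where u': "u' \<in> U" "(u \<otimes> v) [^] n = u' \<otimes> v [^] n" using Suc by blast
  have vn: "v [^] n \<in> V" using subgroup_int_pow_closed[OF V uv(2), of "int n"] by (simp add: int_pow_int)
  have "(u \<otimes> v) [^] Suc n = (u' \<otimes> conj_by G (v [^] n) u) \<otimes> v [^] Suc n"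
    using u' uv by (simp add: word_simps mc)
  moreover have "u' \<otimes> conj_by G (v [^] n) u \<in> U"
    using u' normaliser_conj_closed[of "v [^] n" U u] N vn uv U by (auto intro: subgroup.m_closed)
  ultimately show ?case by blast
qed

lemma p_set_set_mult:
  assumes U: "subgroup U G" and V: "subgroup V G" and N: "V \<subseteq> normaliser G U"
    and P: "p_set G p U" "p_set G p V"
  shows "p_set G p (U <#> V)"
proof -
  have "\<exists>k. (u \<otimes> v) [^] (p ^ k) = \<one>" if uv: "u \<in> U" "v \<in> V" for u v
  proof -
    note mc = subgroup.mem_carrier[OF U] subgroup.mem_carrier[OF V]
    obtain k where k: "v [^] (p ^ k) = \<one>" using P(2) uv by (auto simp: p_set_def)
    obtain u' where u': "u' \<in> U" "(u \<otimes> v) [^] (p ^ k) = u' \<otimes> v [^] (p ^ k)"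
      using set_mult_pow[OF U V N uv] by blast
    obtain l where l: "u' [^] (p ^ l) = \<one>" using P(1) u' by (auto simp: p_set_def)
    have "(u \<otimes> v) [^] (p ^ (k + l)) = \<one>"
      using uv u' k l mc by (simp add: power_add flip: nat_pow_pow)
    then show ?thesis by blast
  qed
  then show ?thesis by (auto simp: p_set_def set_mult_def)
qed

lemma p_set_generate_single:
  assumes x: "x \<in> carrier G" and k: "x [^] (p ^ k :: nat) = \<one>"
  shows "p_set G p (generate G {x})"
proof -
  have "(x [^] (i::int)) [^] (p ^ k :: nat) = \<one>" for i
  proof -
    have "(x [^] i) [^] (p ^ k :: nat) = (x [^] (int (p ^ k))) [^] i"
      using x by (metis int_pow_int int_pow_pow mult.commute)
    also have "x [^] (int (p ^ k)) = x [^] (p ^ k)" by (rule int_pow_int)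
    finally show ?thesis using x k by simp
  qed
  then show ?thesis using generate_pow[OF x] by (auto simp: p_set_def)
qed

lemma p_set_conj_by:
  assumes "p_set G p A" "A \<subseteq> carrier G" "x \<in> carrier G"
  shows "p_set G p (conj_by G x ` A)"
  using assms by (auto simp: p_set_def conj_by_pow) (metis conj_by_one_image conj_by_pow r_one r_inv subsetD)

end

section \<open>Baer's theorem for Engel p-elements\<close>

text \<open>
  The normaliser condition in \<open>p\<close>-groups, for sets of the form "subgroup intersected with \<open>C\<close>" in place
  of subgroups. If the \<open>p\<close>-group generated by \<open>A\<close> fixes \<open>B\<close>, every element of \<open>A\<close> normalises \<open>B\<close>. If it
  moves \<open>B\<close>, the number of conjugates of \<open>B\<close> under it is divisible by \<open>p\<close>. The group generated
  by \<open>B\<close> fixes the conjugate \<open>B\<close>, hence also another one, \<open>u B u\<^sup>-\<close>. Consequently the elements of \<open>u\<^sup>- B u\<close> normalise \<open>B\<close>, and not all of them lie in \<open>B\<close>.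
\<close>

lemma (in group) p_group_normaliser_grows:
  assumes p: "prime p" and fin: "finite (carrier G)" and C: "C \<subseteq> carrier G"
    and A: "A \<subseteq> C" "C \<inter> generate G A = A" "p_set G p (generate G A)" "A \<subseteq> normaliser G C"
    and B: "B \<subset> A" "C \<inter> generate G B = B"
  shows "\<exists>s\<in>A - B. s \<in> normaliser G B"
proof -
  define U where "U = generate G A"
  define W where "W = generate G B"
  have Ac: "A \<subseteq> carrier G" and Bc: "B \<subseteq> carrier G" using A B C by auto
  have U: "subgroup U G" and W: "subgroup W G" unfolding U_def W_def using Ac Bc generate_is_subgroup by auto
  note Uc = subgroup.mem_carrier[OF U]
  have AU: "A \<subseteq> U" and BW: "B \<subseteq> W" unfolding U_def W_def by (auto intro: generate.incl)
  have WU: "W \<subseteq> U" unfolding U_def W_def using B(1) mono_generate by blast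
  have UC: "U \<subseteq> normaliser G C"
    unfolding U_def using generate_subgroup_incl[OF A(4) normaliser_subgroup[OF C]] .
  have conj_in: "conj_by G u b \<in> A" if "u \<in> U" "b \<in> A" for u b
  proof -
    have "conj_by G u b \<in> C" by (rule normaliser_conj_closed) (use that UC A(1) in auto)
    moreover have "b \<in> U" using that AU by blast
    then have "conj_by G u b \<in> U" using U that by (simp add: subgroup.m_closed subgroup.m_inv_closed)
    ultimately show ?thesis using A(2) unfolding U_def by blast
  qed
  have "b \<in> normaliser G B" if b: "b \<in> B" for b
  proof -
    have bU: "b \<in> U" "b \<in> W" using b B AU BW by auto
    have sub: "conj_by G b a \<in> B" if "a \<in> B" for a
    proof -
      have "conj_by G b a \<in> C" by (rule normaliser_conj_closed) (use that bU UC A(1) B(1) in auto)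
      moreover have "a \<in> W" using that BW by blast
      then have "conj_by G b a \<in> W" using W bU by (simp add: subgroup.m_closed subgroup.m_inv_closed)
      ultimately show ?thesis using B(2) unfolding W_def by blast
    qed
    then show ?thesis
      using torsion_in_normaliser[OF _ pow_order_eq_1 _ Bc] order_gt_0_iff_finite fin Bc b by blast
  qed
  then have WB: "W \<subseteq> normaliser G B"
    unfolding W_def using generate_subgroup_incl[OF _ normaliser_subgroup[OF Bc]] by blast
  define J where "J = (\<lambda>u. conj_by G u ` B) ` U"
  have finJ: "finite J" unfolding J_def using U fin subgroup.finite_imp_card_positive
    by (meson finite_imageI finite_subset subgroup.subset)
  have Jc: "Y \<subseteq> carrier G" if "Y \<in> J" for Y
    using that Bc Uc by (auto simp: J_def)
  have BJ: "B \<in> J"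
    unfolding J_def using subgroup.one_closed[OF U] conj_by_one_image[OF Bc] by force
  have transJ: "\<exists>u\<in>U. conj_by G u ` Y = Z" if YZ: "Y \<in> J" "Z \<in> J" for Y Z
  proof -
    obtain u v where uv: "u \<in> U" "v \<in> U" "Y = conj_by G u ` B" "Z = conj_by G v ` B"
      using YZ unfolding J_def by blast
    have "conj_by G (v \<otimes> inv u) ` Y = conj_by G v ` B"
      using uv Uc Bc by (simp only: conj_by_image_image m_closed inv_closed) (simp add: m_assoc)
    then show ?thesis using uv U by (meson subgroup.m_closed subgroup.m_inv_closed)
  qed
  have dvd: "p dvd card {Y \<in> J. \<exists>g\<in>V. conj_by G g ` Y \<noteq> Y}" if V: "subgroup V G" "V \<subseteq> U" for V
  proof -
    interpret V: group "G\<lparr>carrier := V\<rparr>" using V(1) by (rule subgroup_imp_group)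
    have "p dvd card {Y \<in> J. \<exists>g\<in>carrier (G\<lparr>carrier := V\<rparr>). conj_by G g ` Y \<noteq> Y}"
    proof (rule V.p_action_moved_points[OF p finJ])
      fix g Y assume "g \<in> carrier (G\<lparr>carrier := V\<rparr>)" "Y \<in> J"
      then obtain u where *: "g \<in> U" "u \<in> U" "Y = conj_by G u ` B" using V(2) by (auto simp: J_def)
      then have "conj_by G g ` Y = conj_by G (g \<otimes> u) ` B" "g \<otimes> u \<in> U"
        using conj_by_image_image[of g u B] Uc Bc U by (auto intro: subgroup.m_closed)
      then show "conj_by G g ` Y \<in> J" unfolding J_def by blast
    next
      fix Y assume "Y \<in> J"
      then show "conj_by G \<one>\<^bsub>G\<lparr>carrier := V\<rparr>\<^esub> ` Y = Y"
        using conj_by_one_image Jc by simp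
    next
      fix g h Y assume "g \<in> carrier (G\<lparr>carrier := V\<rparr>)" "h \<in> carrier (G\<lparr>carrier := V\<rparr>)" "Y \<in> J"
      then show "conj_by G (g \<otimes>\<^bsub>G\<lparr>carrier := V\<rparr>\<^esub> h) ` Y = conj_by G g ` conj_by G h ` Y"
        using V Uc Jc conj_by_image_image[of g h Y] by auto
    next
      fix g assume "g \<in> carrier (G\<lparr>carrier := V\<rparr>)"
      then have g: "g \<in> V" "g \<in> U" using V by auto
      then obtain k where "g [^] (p ^ k) = \<one>" using A(3) unfolding p_set_def U_def by blast
      then have "g [^]\<^bsub>G\<lparr>carrier := V\<rparr>\<^esub> (p ^ k) = \<one>" by (simp add: nat_pow_def)
      then have "\<forall>Y\<in>J. conj_by G (g [^]\<^bsub>G\<lparr>carrier := V\<rparr>\<^esub> (p ^ k)) ` Y = Y"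
        using Jc conj_by_one_image by simp
      then show "\<exists>k. \<forall>Y\<in>J. conj_by G (g [^]\<^bsub>G\<lparr>carrier := V\<rparr>\<^esub> (p ^ k)) ` Y = Y" by blast
    qed
    then show ?thesis by simp
  qed
  show ?thesis
  proof (cases "\<exists>Y\<in>J. Y \<noteq> B")
    case False
    obtain s where s: "s \<in> A - B" using B(1) by blast
    then have "s \<in> U" using AU by blast
    then have "conj_by G s ` B = B" using False unfolding J_def by blast
    then show ?thesis using s \<open>s \<in> U\<close> Uc unfolding normaliser_def by blast
  next
    case True
    then obtain Y0 where Y0: "Y0 \<in> J" "Y0 \<noteq> B" by blast
    have "{Y \<in> J. \<exists>g\<in>U. conj_by G g ` Y \<noteq> Y} = J"
      using transJ BJ Y0 by (auto; metis)
    then have pJ: "p dvd card J" using dvd[OF U] by simp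
    define M where "M = {Y \<in> J. \<exists>g\<in>W. conj_by G g ` Y \<noteq> Y}"
    have M: "M \<subseteq> J" "finite M" using finJ unfolding M_def by auto
    have BM: "B \<in> J - M" using BJ WB by (auto simp: normaliser_def M_def)
    have "p dvd card M" unfolding M_def by (rule dvd[OF W WU])
    then have "p dvd card (J - M)" using pJ M by (simp add: card_Diff_subset dvd_diff_nat)
    moreover have "card (J - M) > 0" using BM finJ card_gt_0_iff[of "J - M"] by blast
    ultimately have "card (J - M) \<ge> 2" using p prime_ge_2_nat dvd_imp_le by (meson le_trans)
    then have "J - M \<noteq> {B}" by (intro notI) simp
    then obtain Y where "Y \<in> J - M" "Y \<noteq> B" using BM by blast
    then have Y: "Y \<in> J" "Y \<noteq> B" "\<And>g. g \<in> W \<Longrightarrow> conj_by G g ` Y = Y"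
      unfolding M_def by blast+
    then obtain u where u: "u \<in> U" "Y = conj_by G u ` B" unfolding J_def by blast
    have uc: "u \<in> carrier G" "inv u \<in> U" using u Uc U by (auto simp: subgroup.m_inv_closed)
    define B' where "B' = conj_by G (inv u) ` B"
    have "B' \<noteq> B"
    proof
      assume "B' = B"
      then have "conj_by G u ` B = conj_by G (u \<otimes> inv u) ` B"
        using conj_by_image_image[of u "inv u" B] uc Bc unfolding B'_def by auto
      then show False using Y(2) u(2) uc Bc conj_by_one_image by simp
    qed
    moreover have "card B' = card B"
      unfolding B'_def using card_image[OF inj_on_subset[OF conj_by_inj[of "inv u"] Bc]] uc by simp
    moreover have "finite B" using Bc fin finite_subset by blast
    ultimately have "\<not> B' \<subseteq> B" using card_subset_eq by blast
    then obtain s where s: "s \<in> B'" "s \<notin> B" by blast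
    then obtain b where b: "b \<in> B" "s = conj_by G (inv u) b" unfolding B'_def by blast
    have "s \<in> A" using conj_in[OF uc(2)] b B(1) by blast
    moreover have "conj_by G s ` B = B"
    proof -
      have bc: "b \<in> carrier G" "b \<in> W" using b Bc BW by blast+
      have "s = inv u \<otimes> (b \<otimes> u)" using b bc uc by (simp add: m_assoc)
      then have "conj_by G s ` B = conj_by G (inv u) ` conj_by G b ` conj_by G u ` B"
        using conj_by_image_image[of b u B] conj_by_image_image[of "inv u" "b \<otimes> u" B] bc uc Bc
        by (simp only: m_closed inv_closed)
      also have "\<dots> = conj_by G (inv u) ` conj_by G u ` B" using Y(3)[OF bc(2)] u by simp
      also have "\<dots> = B" using uc Bc conj_by_image_image[of "inv u" u B] conj_by_one_image by simp
      finally show ?thesis .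
    qed
    moreover have "s \<in> carrier G" using \<open>s \<in> A\<close> Ac by blast
    ultimately show ?thesis using s unfolding normaliser_def by blast
  qed
qed

text \<open>
  Suppose not. Then there are distinct subsets \<open>S\<close> and \<open>T\<close> of \<open>C\<close> maximal for generating a \<open>p\<close>-group; choose
  them with \<open>I = S \<inter> T\<close> as large as possible. By the normaliser condition there are \<open>s \<in> S\<close> and \<open>t \<in> T\<close>
  outside \<open>I\<close> that normalise \<open>I\<close>. If \<open>r \<in> C\<close> normalises \<open>I\<close> and \<open>r\<^sup>- s r\<close> is in \<open>S\<close>, then the maximal sets \<open>S\<close>
  and \<open>r\<^sup>- S r\<close> share \<open>I\<close> and \<open>r\<^sup>- s r\<close>, hence coincide; so \<open>r\<close> normalises \<open>S\<close> and belongs to it by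
  maximality. Starting from \<open>[t,\<^sub>m s] = 1\<close>, this fact is applied along the Engel sequence down to
  \<open>t \<in> S\<close>, which contradicts the choice of \<open>t\<close>.
\<close>

theorem (in group) engel_p_elements_generate_p_group:
  assumes p: "prime p" and fin: "finite (carrier G)" and C: "C \<subseteq> carrier G"
    and closed: "\<And>s t. s \<in> C \<Longrightarrow> t \<in> C \<Longrightarrow> conj_by G s t \<in> C"
    and P: "p_set G p C"
    and engel: "\<And>s t. s \<in> C \<Longrightarrow> t \<in> C \<Longrightarrow> \<exists>n. iter_comm G t n (conj_by G s) = \<one>"
  shows "p_set G p (generate G C)"
proof (rule ccontr)
  assume notp: "\<not> p_set G p (generate G C)"
  define ok where "ok A \<longleftrightarrow> A \<subseteq> C \<and> p_set G p (generate G A)" for A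
  define maxl where "maxl A \<longleftrightarrow> ok A \<and> (\<forall>B. ok B \<and> A \<subseteq> B \<longrightarrow> B = A)" for A
  have finC: "finite C" using C fin finite_subset by blast
  have okC: "A \<subseteq> carrier G" if "ok A" for A using that C by (auto simp: ok_def)
  have maxl_ok: "ok A" if "maxl A" for A using that by (simp add: maxl_def)
  have ex_maxl: "\<exists>B. maxl B \<and> A \<subseteq> B" if A: "ok A" for A
  proof -
    have "finite {B. ok B}" by (rule finite_subset[of _ "Pow C"]) (auto simp: ok_def finC)
    then have "\<exists>B\<in>{B. ok B}. A \<subseteq> B \<and> (\<forall>D\<in>{B. ok B}. B \<subseteq> D \<longrightarrow> B = D)"
      using finite_has_maximal2[of "{B. ok B}" A] A by auto
    then show ?thesis unfolding maxl_def by blast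
  qed
  have CN: "C \<subseteq> normaliser G C"
  proof
    fix s assume s: "s \<in> C"
    then show "s \<in> normaliser G C"
      using torsion_in_normaliser[OF _ pow_order_eq_1 _ C] order_gt_0_iff_finite fin C closed by blast
  qed
  define N where "N = generate G C"
  have N: "subgroup N G" unfolding N_def using generate_is_subgroup[OF C] .
  have NN: "N \<subseteq> normaliser G C"
    unfolding N_def using generate_subgroup_incl[OF CN normaliser_subgroup[OF C]] .
  have CsubN: "C \<subseteq> N" unfolding N_def by (auto intro: generate.incl)
  have Nc: "r \<in> carrier G" if "r \<in> N" for r using N that by (rule subgroup.mem_carrier)
  have conjN: "conj_by G r s \<in> C" if "r \<in> N" "s \<in> C" for r s
    by (rule normaliser_conj_closed) (use that NN in auto)
  have conjN': "inv r \<otimes> s \<otimes> r \<in> C" if "r \<in> N" "s \<in> C" for r s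
    by (rule normaliser_inv_conj_closed) (use that NN C in auto)
  have self: "C \<inter> generate G A = A" if A: "maxl A" for A
  proof -
    have Ac: "A \<subseteq> carrier G" using okC maxl_ok A by blast
    have sub: "A \<subseteq> C \<inter> generate G A" using A by (auto simp: maxl_def ok_def intro: generate.incl)
    have "generate G (C \<inter> generate G A) \<subseteq> generate G A"
      using generate_subgroup_incl[OF _ generate_is_subgroup[OF Ac]] by blast
    moreover have "p_set G p (generate G A)" using A by (simp add: maxl_def ok_def)
    ultimately have "ok (C \<inter> generate G A)" using p_set_subset unfolding ok_def by blast
    then show ?thesis using A sub by (simp add: maxl_def)
  qed
  \<comment> \<open>If \<open>r\<close> normalises \<open>A\<close>, then \<open>A\<close> and \<open>r\<close>
    together still generate a \<open>p\<close>-group.\<close>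
  have absorb: "r \<in> A" if A: "maxl A" and r: "r \<in> C" "r \<in> normaliser G A" for A r
  proof -
    have Ac: "A \<subseteq> carrier G" using okC maxl_ok A by blast
    have rc: "r \<in> carrier G" using r C by blast
    let ?U = "generate G A" and ?V = "generate G {r}"
    have U: "subgroup ?U G" and V: "subgroup ?V G" using generate_is_subgroup Ac rc by auto
    have Uc: "?U \<subseteq> carrier G" using U by (rule subgroup.subset)
    have "r \<in> normaliser G ?U" using normaliser_generate[OF Ac] r by blast
    then have VN: "?V \<subseteq> normaliser G ?U"
      using generate_subgroup_incl[OF _ normaliser_subgroup[OF Uc]] by simp
    obtain k where "r [^] (p ^ k) = \<one>" using P r by (auto simp: p_set_def)
    then have PV: "p_set G p ?V" using p_set_generate_single rc by blast
    have PU: "p_set G p ?U" using A by (auto simp: maxl_def ok_def)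
    have "insert r A \<subseteq> ?U <#> ?V"
    proof
      fix a assume "a \<in> insert r A"
      then show "a \<in> ?U <#> ?V"
      proof
        assume "a = r"
        then have "a = \<one> \<otimes> r" using rc by simp
        then show ?thesis using generate.one[of G A] generate.incl[of r "{r}" G]
          unfolding set_mult_def by blast
      next
        assume "a \<in> A"
        then have "a = a \<otimes> \<one>" using Ac by auto
        then show ?thesis using generate.one[of G "{r}"] generate.incl[OF \<open>a \<in> A\<close>, of G]
          unfolding set_mult_def by blast
      qed
    qed
    then have "generate G (insert r A) \<subseteq> ?U <#> ?V"
      by (rule generate_subgroup_incl) (rule set_mult_subgroup[OF U V VN])
    then have "ok (insert r A)"
      using p_set_subset[OF p_set_set_mult[OF U V VN PU PV]] r A by (auto simp: ok_def maxl_def)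
    then have "insert r A = A" using A by (auto simp: maxl_def)
    then show ?thesis by blast
  qed
  have ok_conj: "ok (conj_by G r ` A)" if A: "ok A" and r: "r \<in> N" for A r
  proof -
    interpret f: group_hom G G "conj_by G r" using conj_by_hom[OF Nc[OF r]] by unfold_locales
    have "generate G (conj_by G r ` A) = conj_by G r ` generate G A"
      using f.generate_img[OF okC[OF A]] .
    moreover have "generate G A \<subseteq> carrier G"
      using generate_is_subgroup[OF okC[OF A]] subgroup.subset by blast
    ultimately show ?thesis
      using A p_set_conj_by[of p "generate G A" r] Nc[OF r] conjN[OF r] by (auto simp: ok_def)
  qed
  have maxl_conj: "maxl (conj_by G r ` A)" if A: "maxl A" and r: "r \<in> N" for A r
  proof -
    have rc: "r \<in> carrier G" "inv r \<in> N" using Nc r N by (auto simp: subgroup.m_inv_closed)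
    have "B = conj_by G r ` A" if B: "ok B" "conj_by G r ` A \<subseteq> B" for B
    proof -
      have Bc: "B \<subseteq> carrier G" using okC[OF B(1)] .
      have Ac: "A \<subseteq> carrier G" using okC maxl_ok A by blast
      have "conj_by G (inv r) ` conj_by G r ` A \<subseteq> conj_by G (inv r) ` B" using B(2) by (rule image_mono)
      then have "A \<subseteq> conj_by G (inv r) ` B"
        using conj_by_image_image[of "inv r" r A] conj_by_one_image rc Ac by simp
      then have "conj_by G (inv r) ` B = A"
        using A ok_conj[OF B(1) rc(2)] by (simp add: maxl_def)
      then have "conj_by G r ` A = conj_by G r ` conj_by G (inv r) ` B" by simp
      also have "\<dots> = B"
        using conj_by_image_image[of r "inv r" B] conj_by_one_image rc Bc by simp
      finally show ?thesis by simp
    qed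
    then show ?thesis using ok_conj[OF maxl_ok[OF A] r] unfolding maxl_def by simp
  qed
  have two: "\<exists>S T. maxl S \<and> maxl T \<and> S \<noteq> T"
  proof -
    have "ok {}" using generate_empty by (auto simp: ok_def p_set_def)
    then obtain S where S: "maxl S" using ex_maxl by blast
    then have "S \<noteq> C" using notp by (auto simp: maxl_def ok_def)
    then obtain c where c: "c \<in> C" "c \<notin> S" using S by (auto simp: maxl_def ok_def)
    have "ok {c}"
      using c C P p_set_generate_single[of c p] unfolding ok_def p_set_def by auto
    then obtain T where "maxl T" "c \<in> T" using ex_maxl[of "{c}"] by auto
    then show ?thesis using S c by metis
  qed
  define Pr where "Pr = (\<lambda>(S, T). maxl S \<and> maxl T \<and> S \<noteq> T)"
  obtain S0 T0 where 0: "Pr (S0, T0)" using two unfolding Pr_def by blast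
  have bnd: "\<forall>y. Pr y \<longrightarrow> card (fst y \<inter> snd y) < Suc (card C)"
    using finC by (auto simp: Pr_def maxl_def ok_def less_Suc_eq_le intro!: card_mono)
  obtain ST where ST: "Pr ST" "\<And>y. Pr y \<Longrightarrow> card (fst y \<inter> snd y) \<le> card (fst ST \<inter> snd ST)"
    using ex_has_greatest_nat[OF 0 bnd] by blast
  obtain S T where ST_eq: "ST = (S, T)" by (cases ST)
  have S: "maxl S" and T: "maxl T" and "S \<noteq> T" using ST(1) unfolding ST_eq Pr_def by auto
  define I where "I = S \<inter> T"
  have unique: "D = S" if D: "maxl D" "A \<subseteq> S \<inter> D" "card I < card A" for A D
  proof (rule ccontr)
    assume "D \<noteq> S"
    then have "card (S \<inter> D) \<le> card I" using ST(2)[of "(S, D)"] S D by (simp add: Pr_def ST_eq I_def)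
    moreover have "finite (S \<inter> D)" using S finC finite_subset by (auto simp: maxl_def ok_def)
    then have "card A \<le> card (S \<inter> D)" using D(2) card_mono by blast
    ultimately show False using D(3) by linarith
  qed
  have Sc: "S \<subseteq> C" "S \<subseteq> carrier G" and Tc: "T \<subseteq> C" "T \<subseteq> carrier G"
    using S T maxl_ok okC by (auto simp: ok_def)
  have Ic: "I \<subseteq> carrier G" "I \<subseteq> C" using Sc unfolding I_def by auto
  have selfI: "C \<inter> generate G I = I"
  proof
    show "C \<inter> generate G I \<subseteq> I"
      using self[OF S] self[OF T] mono_generate[of I S] mono_generate[of I T] unfolding I_def by blast
    show "I \<subseteq> C \<inter> generate G I" using Ic by (auto intro: generate.incl)
  qed
  have strict: "I \<subset> S" "I \<subset> T"
    using S T \<open>S \<noteq> T\<close> unfolding I_def maxl_def by blast+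
  have grow: "\<exists>s\<in>A - I. s \<in> normaliser G I" if A: "maxl A" "I \<subset> A" for A
  proof (rule p_group_normaliser_grows[OF p fin C _ self[OF A(1)] _ _ A(2) selfI])
    show "A \<subseteq> C" "p_set G p (generate G A)" using A by (auto simp: maxl_def ok_def)
    then show "A \<subseteq> normaliser G C" using CN by blast
  qed
  obtain s where s: "s \<in> S" "s \<notin> I" "s \<in> normaliser G I" using grow[OF S strict(1)] by blast
  obtain t where t: "t \<in> T" "t \<notin> I" "t \<in> normaliser G I" using grow[OF T strict(2)] by blast
  have sC: "s \<in> C" "t \<in> C" using s t Sc Tc by auto
  have sc: "s \<in> carrier G" "t \<in> carrier G" "s \<in> N" "t \<in> N" using sC C CsubN by auto
  have pull: "r \<in> S" if r: "r \<in> C" "r \<in> normaliser G I" and rs: "inv r \<otimes> s \<otimes> r \<in> S" for r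
  proof -
    have rc: "r \<in> carrier G" "r \<in> N" "inv r \<in> N" using r C CsubN N by (auto simp: subgroup.m_inv_closed)
    let ?D = "conj_by G (inv r) ` S"
    let ?s = "inv r \<otimes> s \<otimes> r"
    have D: "maxl ?D" using maxl_conj[OF S rc(3)] .
    have "?s \<in> ?D" using s(1) rc(1) by (intro image_eqI[of _ _ s]) simp_all
    moreover have "I \<subseteq> ?D"
    proof
      fix i assume i: "i \<in> I"
      have "conj_by G r i \<in> S" using normaliser_conj_closed[OF r(2) i] unfolding I_def by simp
      moreover have "i = conj_by G (inv r) (conj_by G r i)" using i Ic rc by (auto simp: word_simps)
      ultimately show "i \<in> ?D" by blast
    qed
    ultimately have sub: "insert ?s I \<subseteq> S \<inter> ?D" using rs unfolding I_def by blast
    have "?s \<notin> I"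
    proof
      assume "?s \<in> I"
      then have "conj_by G r ?s \<in> I" using normaliser_conj_closed[OF r(2)] by blast
      then show False using s(2) rc sc by (simp add: word_simps)
    qed
    moreover have "finite I" using Ic finC finite_subset by blast
    ultimately have "card I < card (insert ?s I)" by simp
    then have "?D = S" using unique[OF D sub] by blast
    then have "inv r \<in> normaliser G S" using rc by (simp add: normaliser_def)
    then have "inv (inv r) \<in> normaliser G S" by (rule subgroup.m_inv_closed[OF normaliser_subgroup[OF Sc(2)]])
    then show ?thesis using absorb[OF S r(1)] rc by simp
  qed
  define M where "M = N \<inter> normaliser G I"
  have M: "subgroup M G" unfolding M_def by (rule subgroups_Inter_pair[OF N normaliser_subgroup[OF Ic(1)]])
  have stM: "s \<in> M" "t \<in> M" using s t sc unfolding M_def by auto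
  \<comment> \<open>With \<open>r n = (g n)\<^sup>- s (g n)\<close> the Engel sequence satisfies \<open>g (n + 1) = (r
    n) s\<^sup>-\<close>.\<close>
  define g where "g n = iter_comm G t n (conj_by G s)" for n
  have gM: "g n \<in> M" for n
    by (induction n) (simp_all add: g_def stM M subgroup.m_closed subgroup.m_inv_closed)
  define r where "r n = inv (g n) \<otimes> s \<otimes> g n" for n
  have rM: "r n \<in> M" for n
    using gM[of n] stM M by (simp add: r_def subgroup.m_closed subgroup.m_inv_closed)
  have rC: "r n \<in> C" for n
    unfolding r_def using conjN' gM[of n] sC(1) unfolding M_def by blast
  have gc: "g n \<in> carrier G" for n using gM M subgroup.mem_carrier by metis
  have g_Suc: "g (Suc n) = r n \<otimes> inv s" for n
    using gc[of n] sc unfolding r_def by (simp add: g_def m_assoc)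
  obtain m where m: "g m = \<one>" using engel[OF sC] unfolding g_def by blast
  have descend: "r n \<in> S" if "r (Suc n) \<in> S" for n
  proof -
    have rc: "r n \<in> carrier G" using rC C by blast
    have SN: "s \<in> normaliser G S"
    proof -
      have "conj_by G s a \<in> S" if a: "a \<in> S" for a
      proof -
        have gs: "s \<in> generate G S" "a \<in> generate G S" using s(1) a by (auto intro: generate.incl)
        have "conj_by G s a \<in> generate G S"
          using gs generate_is_subgroup[OF Sc(2)] by (simp add: subgroup.m_closed subgroup.m_inv_closed)
        moreover have "conj_by G s a \<in> C" using closed sC a Sc by blast
        ultimately show ?thesis using self[OF S] by blast
      qed
      moreover have "order G > 0" using fin order_gt_0_iff_finite by blast
      ultimately show ?thesis
        by (intro torsion_in_normaliser[OF sc(1) pow_order_eq_1[OF sc(1)] _ Sc(2)])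
    qed
    \<comment> \<open>Hence \<open>r (n + 1)\<close> is conjugate under \<open>s\<close> to \<open>(r n)\<^sup>- s (r
      n)\<close>, and the fact \<open>pull\<close> applies to \<open>r n\<close>.\<close>
    have "r (Suc n) = s \<otimes> (inv (r n) \<otimes> s \<otimes> r n) \<otimes> inv s"
      unfolding r_def[of "Suc n"] g_Suc using rc sc by (simp add: word_simps)
    then have "inv (r n) \<otimes> s \<otimes> r n = inv s \<otimes> r (Suc n) \<otimes> s"
      using rc sc by (simp add: word_simps)
    also have "\<dots> \<in> S" using normaliser_inv_conj_closed[OF SN that Sc(2)] .
    finally show ?thesis using pull[OF rC] rM unfolding M_def by blast
  qed
  have "r m \<in> S" using m s(1) sc by (simp add: r_def)
  then have "r 0 \<in> S"
    by (induction m) (simp_all add: descend)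
  then have "t \<in> S" using pull[OF sC(2) t(3)] by (simp add: r_def g_def)
  then show False using t unfolding I_def by blast
qed

section \<open>Engel elements\<close>

definition engel_on :: "('a, 'b) monoid_scheme \<Rightarrow> 'a set \<Rightarrow> 'a \<Rightarrow> bool" where
  "engel_on G F x \<longleftrightarrow> (\<forall>g\<in>F. \<exists>n. iter_comm G g n (conj_by G x) = \<one>\<^bsub>G\<^esub>)"

lemma iter_comm_Suc_shift:
  "iter_comm G g (Suc n) x = iter_comm G (inv\<^bsub>G\<^esub> g \<otimes>\<^bsub>G\<^esub> x g) n x"
  by (induction n) simp_all

lemma (in group_hom) hom_iter_comm:
  assumes x: "x \<in> carrier G" and g: "g \<in> carrier G"
  shows "iter_comm G g n (conj_by G x) \<in> carrier G \<and>
    h (iter_comm G g n (conj_by G x)) = iter_comm H (h g) n (conj_by H (h x))"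
  using x g by (induction n) simp_all

context group
begin

definition centraliser :: "'a set \<Rightarrow> 'a set" where
  "centraliser A = {x \<in> carrier G. \<forall>a\<in>A. conj_by G x a = a}"

lemma centraliser_subgroup:
  assumes A: "A \<subseteq> carrier G" shows "subgroup (centraliser A) G"
proof
  fix x y assume xy: "x \<in> centraliser A" "y \<in> centraliser A"
  have "conj_by G (x \<otimes> y) a = a" if "a \<in> A" for a
    using xy that A conj_by_conj_by[of x y a] by (auto simp: centraliser_def)
  then show "x \<otimes> y \<in> centraliser A" using xy by (auto simp: centraliser_def)
next
  fix x assume x: "x \<in> centraliser A"
  have "conj_by G (inv x) a = a" if "a \<in> A" for a
  proof -
    have xa: "conj_by G x a = a" "x \<in> carrier G" "a \<in> carrier G"
      using x that A by (auto simp: centraliser_def)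
    have "conj_by G (inv x) (conj_by G x a) = a" using xa(2,3) by (simp add: word_simps)
    then show ?thesis using xa(1) by simp
  qed
  then show "inv x \<in> centraliser A" using x by (auto simp: centraliser_def)
qed (use A in \<open>auto simp: centraliser_def\<close>)

text \<open>
  The last non-trivial term of an Engel sequence is fixed.
\<close>

lemma engel_fixed_point:
  assumes F: "subgroup F G" "F \<noteq> {\<one>}" and x: "x \<in> carrier G"
    and closed: "\<And>f. f \<in> F \<Longrightarrow> conj_by G x f \<in> F" and engel: "engel_on G F x"
  shows "\<exists>f\<in>F. f \<noteq> \<one> \<and> conj_by G x f = f"
proof -
  obtain f where f: "f \<in> F" "f \<noteq> \<one>" using F subgroup.one_closed by blast
  define e where "e n = iter_comm G f n (conj_by G x)" for n
  have eF: "e n \<in> F" for n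
    by (induction n) (use f F closed in \<open>simp_all add: e_def subgroup.m_closed subgroup.m_inv_closed\<close>)
  obtain n where "e n = \<one>" using engel f unfolding engel_on_def e_def by blast
  then have "e (LEAST n. e n = \<one>) = \<one>" by (rule LeastI)
  moreover from this have "(LEAST n. e n = \<one>) \<noteq> 0" using f by (auto simp: e_def intro: ccontr)
  then obtain m where m: "(LEAST n. e n = \<one>) = Suc m" using not0_implies_Suc by blast
  ultimately have "inv (e m) \<otimes> conj_by G x (e m) = \<one>" unfolding e_def by simp
  moreover have "e m \<in> carrier G" using eF F(1) subgroup.mem_carrier by metis
  ultimately have "conj_by G x (e m) = e m" using x by (metis inv_equality inv_inv inv_closed m_closed)
  moreover have "e m \<noteq> \<one>" using m not_less_Least[of m "\<lambda>n. e n = \<one>"] by simp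
  ultimately show ?thesis using eF by blast
qed

text \<open>
  If \<open>c = [h,x]\<close> is fixed by \<open>x\<close>, then \<open>x\<^sup>j\<close> takes \<open>h\<close> to \<open>h c\<^sup>j\<close>, so \<open>c\<^sup>m = 1\<close>; but \<open>c\<close> has \<open>p\<close>-power order. Thus
  an Engel sequence that reaches \<open>1\<close> has reached it after one step.
\<close>

lemma coprime_engel_centralises:
  assumes F: "subgroup F G" "p_set G p F" and x: "x \<in> carrier G"
    and closed: "\<And>f. f \<in> F \<Longrightarrow> conj_by G x f \<in> F" and engel: "engel_on G F x"
    and m: "x [^] (m::nat) = \<one>" "coprime m p"
  shows "x \<in> centraliser F"
proof -
  have "conj_by G x f = f" if f: "f \<in> F" for f
  proof -
    define e where "e n = iter_comm G f n (conj_by G x)" for n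
    have eF: "e n \<in> F" for n
      by (induction n) (use f F closed in \<open>simp_all add: e_def subgroup.m_closed subgroup.m_inv_closed\<close>)
    then have ec: "e n \<in> carrier G" for n using F(1) subgroup.mem_carrier by metis
    have e_Suc: "conj_by G x (e n) = e n \<otimes> e (Suc n)" for n
      using ec[of n] x by (simp add: e_def inv_mult_cancel)
    have descend: "e (Suc n) = \<one>" if "e (Suc (Suc n)) = \<one>" for n
    proof -
      let ?h = "e n" and ?c = "e (Suc n)"
      have hc: "conj_by G x ?h = ?h \<otimes> ?c" "conj_by G x ?c = ?c"
        using e_Suc[of n] e_Suc[of "Suc n"] that ec[of "Suc n"] by simp_all
      have "conj_by G (x [^] j) ?h = ?h \<otimes> ?c [^] j" for j :: nat
      proof (induction j)
        case (Suc j)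
        have "conj_by G (x [^] Suc j) ?h = conj_by G x (conj_by G (x [^] j) ?h)"
          using conj_by_conj_by[of x "x [^] j" ?h] nat_pow_Suc2[OF x, of j] x ec by simp
        also have "\<dots> = conj_by G x ?h \<otimes> conj_by G x (?c [^] j)"
          using Suc x ec[of n] ec[of "Suc n"] hom_mult[OF conj_by_hom[OF x], of ?h "?c [^] j"] by simp
        also have "\<dots> = ?h \<otimes> ?c \<otimes> ?c [^] j"
          using hc conj_by_pow[OF x ec[of "Suc n"], of j] by simp
        also have "\<dots> = ?h \<otimes> ?c [^] Suc j"
          using ec[of n] ec[of "Suc n"] nat_pow_Suc2[of ?c j] by (simp add: m_assoc)
        finally show ?case .
      qed (use ec in simp)
      from this[of m] have "?h \<otimes> ?c [^] m = ?h" using m ec by simp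
      then have "?c [^] m = \<one>" using ec[of n] ec[of "Suc n"] by (metis l_cancel_one nat_pow_closed)
      then have 1: "ord ?c dvd m" using pow_eq_id ec by blast
      obtain k where "?c [^] (p ^ k) = \<one>" using F(2) eF by (auto simp: p_set_def)
      then have "ord ?c dvd p ^ k" using pow_eq_id ec by blast
      then have "ord ?c = 1" using 1 m(2) by (metis coprime_common_divisor_nat coprime_power_right_iff)
      then show ?thesis using ord_eq_1 ec by blast
    qed
    obtain n where "e n = \<one>" using engel f unfolding engel_on_def e_def by blast
    moreover have "e (Suc 0) = \<one>" if "e (Suc n) = \<one>" for n
      using that by (induction n) (auto dest: descend)
    moreover have "e 0 = \<one> \<Longrightarrow> e (Suc 0) = \<one>" using x by (simp add: e_def)
    ultimately have "e (Suc 0) = \<one>" by (metis not0_implies_Suc)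
    then show ?thesis using e_Suc[of 0] f ec[of 0] by (simp add: e_def)
  qed
  then show ?thesis using x by (simp add: centraliser_def)
qed

text \<open>
  An element of finite order is a product of powers of itself that have prime power order: split off one
  prime from the order and use Bezout's identity.
\<close>

lemma subgroup_contains_if_prime_power_parts:
  assumes S: "subgroup S G" and n: "(n::nat) > 0"
    and "x \<in> carrier G" "x [^] n = \<one>"
    and "\<And>i q k. prime q \<Longrightarrow> (x [^] (i::nat)) [^] (q ^ k :: nat) = \<one> \<Longrightarrow> x [^] i \<in> S"
  shows "x \<in> S"
  using n assms(3-5)
proof (induction n arbitrary: x rule: less_induct)
  case (less n)
  note x = less.prems(2)
  show ?case
  proof (cases "n = 1")
    case True
    then show ?thesis using less.prems S by (simp add: subgroup.one_closed)
  next
    case False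
    then obtain q where q: "prime q" "q dvd n" using prime_factor_nat by blast
    obtain k b where kb: "n = q ^ k * b" "\<not> q dvd b"
      using prime_power_canonical[of q n] q less.prems by (metis mult.commute)
    have "k \<noteq> 0" using kb q by (metis mult_1 power_0)
    show ?thesis
    proof (cases "b = 1")
      case True
      then have "(x [^] (1::nat)) [^] (q ^ k) = \<one>" using kb less.prems x by simp
      then have "x [^] (1::nat) \<in> S" by (rule less.prems(4)[OF q(1)])
      then show ?thesis using x by simp
    next
      case False
      define a where "a = q ^ k"
      have nab: "n = a * b" using kb a_def by simp
      have "a > 1" using q \<open>k \<noteq> 0\<close> prime_gt_1_nat one_less_power unfolding a_def by blast
      have "b > 1" using False less.prems(1) nab by (cases b) auto
      have "coprime a b" using kb q unfolding a_def by (simp add: prime_imp_coprime)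
      have sub: "x [^] i \<in> S" if "i < n" "i > 0" "x [^] (j * i) = \<one>" "j < n" "j > 0" for i j
      proof (rule less.IH[OF \<open>j < n\<close> \<open>j > 0\<close>])
        show "(x [^] i) [^] j = \<one>" using that x by (simp add: nat_pow_pow mult.commute)
        fix l q' k' :: nat assume "prime q'" "((x [^] i) [^] l) [^] (q' ^ k') = \<one>"
        then show "(x [^] i) [^] l \<in> S" using less.prems(4)[of q' "i * l" k'] x by (simp add: nat_pow_pow)
      qed (use x in simp)
      have "a < n" "b < n" using \<open>a > 1\<close> \<open>b > 1\<close> nab by auto
      then have xS: "x [^] a \<in> S" "x [^] b \<in> S"
        using sub[of a b] sub[of b a] \<open>a > 1\<close> \<open>b > 1\<close> less.prems(3) nab by (auto simp: mult.commute)
      obtain u v :: int where uv: "u * int a + v * int b = 1"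
        using \<open>coprime a b\<close> bezout_int[of "int a" "int b"] by (auto simp: coprime_iff_gcd_eq_1 gcd_int_int_eq)
      have "x = x [^] (u * int a + v * int b)" using uv x by simp
      also have "\<dots> = (x [^] int a) [^] u \<otimes> (x [^] int b) [^] v"
        using x by (simp add: int_pow_mult int_pow_pow mult.commute)
      also have "\<dots> = (x [^] a) [^] u \<otimes> (x [^] b) [^] v" by (simp add: int_pow_int)
      finally show ?thesis
        using subgroup_int_pow_closed[OF S xS(1)] subgroup_int_pow_closed[OF S xS(2)] S
        by (metis subgroup.m_closed)
    qed
  qed
qed

end

section \<open>Engel subgroups centralise chief factors\<close>

text \<open>
  The \<open>F\<close>-conjugates of \<open>x\<close> lie in the coset \<open>F x\<close>, so the commutator of two of them lies in \<open>F\<close>, where all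
  of them are Engel. By Baer's theorem they generate a \<open>p\<close>-group. It is normalised by \<open>F\<close> and contains
  \<open>f\<^sup>- x f x\<^sup>- \<noteq> 1\<close>, so its intersection with \<open>F\<close> is as required.
\<close>

lemma (in group) engel_p_element_gives_normal_p_subgroup:
  assumes fin: "finite (carrier G)" and p: "prime p"
    and F: "subgroup F G" and x: "x \<in> carrier G" "x [^] (p ^ k :: nat) = \<one>" "x \<in> normaliser G F"
    and engel: "engel_on G F x"
    and f: "f \<in> F" "conj_by G x f \<noteq> f"
  shows "\<exists>U. subgroup U G \<and> U \<subseteq> F \<and> F \<subseteq> normaliser G U \<and> p_set G p U \<and> U \<noteq> {\<one>}"
proof -
  note Fc = subgroup.mem_carrier[OF F]
  note Fcl = subgroup.m_closed[OF F] subgroup.m_inv_closed[OF F]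
  have xF: "conj_by G x a \<in> F" if "a \<in> F" for a
    by (rule normaliser_conj_closed[OF x(3) that])
  have xF': "inv x \<otimes> a \<otimes> x \<in> F" if "a \<in> F" for a
    using normaliser_inv_conj_closed[OF x(3) that] F subgroup.subset by blast
  define C where "C = (\<lambda>a. conj_by G a x) ` F"
  have C: "C \<subseteq> carrier G" unfolding C_def using x Fc by auto
  have coset: "\<exists>a\<in>F. s = a \<otimes> x" if s: "s \<in> C" for s
  proof -
    obtain b where b: "b \<in> F" "s = conj_by G b x" using s unfolding C_def by blast
    then have "s = (b \<otimes> conj_by G x (inv b)) \<otimes> x" using x Fc by (simp add: word_simps)
    moreover have "b \<otimes> conj_by G x (inv b) \<in> F" using b xF[of "inv b"] Fcl by simp
    ultimately show ?thesis by blast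
  qed
  have conjF: "conj_by G b s \<in> C" if "b \<in> F" "s \<in> C" for b s
  proof -
    obtain a where a: "a \<in> F" "s = conj_by G a x" using \<open>s \<in> C\<close> unfolding C_def by blast
    then have "conj_by G b s = conj_by G (b \<otimes> a) x" using that x Fc by (simp add: word_simps)
    then show ?thesis using a that Fcl unfolding C_def by blast
  qed
  have closed: "conj_by G s t \<in> C" if st: "s \<in> C" "t \<in> C" for s t
  proof -
    obtain a b where ab: "a \<in> F" "s = a \<otimes> x" "b \<in> F" "t = conj_by G b x"
      using coset[OF st(1)] st(2) unfolding C_def by blast
    have "conj_by G s t = conj_by G (a \<otimes> conj_by G x b) x"
      using ab x Fc by (simp add: word_simps)
    moreover have "a \<otimes> conj_by G x b \<in> F" using ab xF Fcl by simp
    ultimately show ?thesis unfolding C_def by blast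
  qed
  have PC: "p_set G p C"
  proof -
    have "conj_by G a x [^] (p ^ k) = \<one>" if "a \<in> F" for a
      using that x Fc conj_by_pow[of a x "p ^ k"] by simp
    then show ?thesis unfolding p_set_def C_def by blast
  qed
  have engelC: "\<exists>n. iter_comm G t n (conj_by G s) = \<one>" if st: "s \<in> C" "t \<in> C" for s t
  proof -
    obtain a b where ab: "a \<in> F" "s = a \<otimes> x" "b \<in> F" "t = b \<otimes> x" using coset st by meson
    define d where "d = inv t \<otimes> conj_by G s t"
    have "d = (inv x \<otimes> (inv b \<otimes> a) \<otimes> x) \<otimes> (b \<otimes> inv a)"
      using ab x Fc by (simp add: d_def word_simps)
    then have d: "d \<in> F" using ab xF'[of "inv b \<otimes> a"] Fcl by simp
    obtain c where c: "c \<in> F" "s = conj_by G c x" using st(1) unfolding C_def by blast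
    have cc: "c \<in> carrier G" "inv c \<in> F" "d \<in> carrier G" using c d Fc Fcl by blast+
    define d' where "d' = conj_by G (inv c) d"
    have d': "d' \<in> F" "d' \<in> carrier G" using cc c(1) d Fcl Fc unfolding d'_def by simp_all
    then obtain n where n: "iter_comm G d' n (conj_by G x) = \<one>" using engel unfolding engel_on_def by blast
    interpret c: group_hom G G "conj_by G c" using conj_by_hom[OF cc(1)] by unfold_locales
    have "iter_comm G (conj_by G c d') n (conj_by G (conj_by G c x)) = conj_by G c (iter_comm G d' n (conj_by G x))"
      using c.hom_iter_comm[OF x(1) d'(2), of n] by (simp only:)
    moreover have "conj_by G c d' = d" using cc unfolding d'_def by (simp add: word_simps)
    ultimately have "iter_comm G d n (conj_by G s) = \<one>" using n c(2) cc(1) by simp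
    then have "iter_comm G t (Suc n) (conj_by G s) = \<one>" by (simp only: iter_comm_Suc_shift d_def)
    then show ?thesis by blast
  qed
  define V where "V = generate G C"
  have V: "subgroup V G" unfolding V_def using generate_is_subgroup[OF C] .
  have PV: "p_set G p V"
    unfolding V_def by (rule engel_p_elements_generate_p_group[OF p fin C closed PC engelC])
  have FV: "F \<subseteq> normaliser G V"
  proof -
    have "b \<in> normaliser G C" if "b \<in> F" for b
    proof (rule torsion_in_normaliser[OF _ pow_order_eq_1 _ C])
      show "order G > 0" using fin order_gt_0_iff_finite by blast
    qed (use that Fc conjF in auto)
    then show ?thesis using normaliser_generate[OF C] unfolding V_def by blast
  qed
  let ?U = "V \<inter> F"
  have U: "subgroup ?U G" using subgroups_Inter_pair[OF V F] .
  have "F \<subseteq> normaliser G ?U"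
  proof
    fix b assume b: "b \<in> F"
    show "b \<in> normaliser G ?U"
    proof (rule torsion_in_normaliser[OF _ pow_order_eq_1])
      show "order G > 0" using fin order_gt_0_iff_finite by blast
      fix a assume "a \<in> ?U"
      then show "conj_by G b a \<in> ?U"
        using b FV normaliser_conj_closed[of b V a] Fcl by auto
    qed (use b Fc U subgroup.subset in blast)+
  qed
  moreover have "?U \<noteq> {\<one>}"
  proof
    let ?e = "inv f \<otimes> conj_by G x f"
    assume U1: "?U = {\<one>}"
    have xV: "conj_by G a x \<in> V" if "a \<in> F" for a
      unfolding V_def C_def using that by (auto intro: generate.incl)
    have "?e = conj_by G (inv f) x \<otimes> inv (conj_by G \<one> x)" using f Fc x by (simp add: word_simps)
    also have "\<dots> \<in> V"
      using xV[of "inv f"] xV[of \<one>] f Fcl V subgroup.one_closed[OF F]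
      by (metis subgroup.m_closed subgroup.m_inv_closed)
    finally have "?e \<in> ?U" using f xF Fcl by simp
    then have "?e = \<one>" using U1 by blast
    then have "f \<otimes> ?e = f" using f Fc by simp
    then show False using f Fc x by (simp add: word_simps)
  qed
  moreover have "p_set G p ?U" using PV p_set_subset by blast
  ultimately show ?thesis using U by blast
qed

text \<open>
  The product of a largest normal \<open>p\<close>-subgroup \<open>M\<close> of \<open>F\<close> and any conjugate of \<open>M\<close> is again a normal \<open>p\<close>-subgroup
  of \<open>F\<close>. So \<open>M\<close> is normal in the whole group, and therefore it is \<open>F\<close>.
\<close>

lemma (in group) chief_factor_with_normal_p_subgroup:
  assumes fin: "finite (carrier G)" and F: "F \<lhd> G"
    and chief: "\<And>E. E \<lhd> G \<Longrightarrow> E \<subseteq> F \<Longrightarrow> E = {\<one>} \<or> E = F"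
    and U: "subgroup U G" "U \<subseteq> F" "F \<subseteq> normaliser G U" "p_set G p U" "U \<noteq> {\<one>}"
  shows "p_set G p F"
proof -
  have Fs: "subgroup F G" using F by (rule normal_imp_subgroup)
  note Fc = subgroup.mem_carrier[OF Fs]
  define Q where "Q V \<longleftrightarrow> subgroup V G \<and> V \<subseteq> F \<and> F \<subseteq> normaliser G V \<and> p_set G p V" for V
  have finF: "finite F" using fin finite_subset subgroup.subset[OF Fs] by blast
  have "Q U" using U unfolding Q_def by blast
  moreover have "\<forall>V. Q V \<longrightarrow> card V < Suc (card F)"
    using finF unfolding Q_def by (auto simp: less_Suc_eq_le intro: card_mono)
  ultimately obtain M where M: "Q M" "\<And>V. Q V \<Longrightarrow> card V \<le> card M"
    using ex_has_greatest_nat[of Q U card] by blast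
  have Ms: "subgroup M G" "M \<subseteq> F" and MN: "F \<subseteq> normaliser G M" and PM: "p_set G p M" using M(1) by (auto simp: Q_def)
  have Mc: "M \<subseteq> carrier G" "finite M" using Ms Fc finF finite_subset by auto
  have absorb: "conj_by G g m \<in> M" if g: "g \<in> carrier G" and m: "m \<in> M" for g m
  proof -
    interpret f: group_hom G G "conj_by G g" using conj_by_hom[OF g] by unfold_locales
    let ?M = "conj_by G g ` M"
    have sub: "subgroup ?M G" using f.subgroup_img_is_subgroup[OF Ms(1)] .
    have MF: "?M \<subseteq> F" using Ms(2) normal.inv_op_closed2[OF F g] by auto
    have P': "p_set G p ?M" using p_set_conj_by[OF PM Mc(1) g] .
    have N': "?M \<subseteq> normaliser G M" using MF MN by blast
    let ?W = "M <#> ?M"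
    have W: "subgroup ?W G" using set_mult_subgroup[OF Ms(1) sub N'] .
    have WF: "?W \<subseteq> F" using MF Ms(2) subgroup.m_closed[OF Fs] by (auto simp: set_mult_def)
    have "F \<subseteq> normaliser G ?W"
    proof
      fix b assume b: "b \<in> F"
      show "b \<in> normaliser G ?W"
      proof (rule torsion_in_normaliser[OF _ pow_order_eq_1])
        show "order G > 0" using fin order_gt_0_iff_finite by blast
        fix a assume "a \<in> ?W"
        then obtain u v where uv: "u \<in> M" "v \<in> M" "a = u \<otimes> conj_by G g v" by (auto simp: set_mult_def)
        let ?b = "inv g \<otimes> b \<otimes> g"
        have c: "u \<in> carrier G" "v \<in> carrier G" "b \<in> carrier G" using uv b Mc Fc by auto
        have "conj_by G b a = conj_by G b u \<otimes> conj_by G g (conj_by G ?b v)"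
          using uv c g by (simp add: word_simps)
        moreover have "conj_by G b u \<in> M"
          by (rule normaliser_conj_closed) (use uv b MN in auto)
        moreover have "?b \<in> F" using normal.inv_op_closed1[OF F g b] .
        then have "conj_by G ?b v \<in> M"
          by (intro normaliser_conj_closed) (use uv MN in auto)
        ultimately show "conj_by G b a \<in> ?W" by (auto simp: set_mult_def)
      qed (use b Fc W subgroup.subset in blast)+
    qed
    then have "Q ?W" using W WF p_set_set_mult[OF Ms(1) sub N' PM P'] by (simp add: Q_def)
    then have "card ?W \<le> card M" by (rule M(2))
    moreover have "M \<subseteq> ?W"
    proof
      fix a assume "a \<in> M"
      then have "a = a \<otimes> \<one>" using Mc by auto
      moreover have "\<one> \<in> ?M" by (rule subgroup.one_closed[OF sub])
      ultimately show "a \<in> ?W" using \<open>a \<in> M\<close> unfolding set_mult_def by blast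
    qed
    moreover have "finite ?W" using WF finF finite_subset by blast
    ultimately have "?W = M" using card_seteq by blast
    moreover have "conj_by G g m \<in> ?W"
    proof -
      have "conj_by G g m = \<one> \<otimes> conj_by G g m" using g m Mc by auto
      then show ?thesis using m subgroup.one_closed[OF Ms(1)] unfolding set_mult_def by blast
    qed
    ultimately show ?thesis by blast
  qed
  then have "M \<lhd> G" using Ms(1) by (intro normal_invI)
  moreover have "M \<noteq> {\<one>}"
  proof
    assume "M = {\<one>}"
    then have "card U \<le> 1" using M(2)[OF \<open>Q U\<close>] by simp
    moreover have "finite U" using U(2) finF finite_subset by blast
    ultimately show False using U(5) subgroup.one_closed[OF U(1)]
      by (metis card_le_Suc0_iff_eq One_nat_def is_singletonI' is_singleton_def singletonD empty_iff)
  qed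
  ultimately have "M = F" using chief Ms(2) by blast
  then show ?thesis using PM by simp
qed

lemma (in group_hom) engel_on_image:
  assumes "x \<in> carrier G" "A \<subseteq> carrier G" "engel_on G A x"
  shows "engel_on H (h ` A) (h x)"
  unfolding engel_on_def
proof
  fix b assume "b \<in> h ` A"
  then obtain a where a: "a \<in> A" "b = h a" by blast
  then obtain n where "iter_comm G a n (conj_by G x) = \<one>" using assms(3) unfolding engel_on_def by blast
  then have "iter_comm H b n (conj_by H (h x)) = \<one>\<^bsub>H\<^esub>"
    using hom_iter_comm[of x a n] a assms by auto
  then show "\<exists>n. iter_comm H b n (conj_by H (h x)) = \<one>\<^bsub>H\<^esub>" by blast
qed

text \<open>
  If all elements of prime power order in \<open>R\<close> centralise \<open>F\<close>, so does \<open>R\<close>. Otherwise \<open>F\<close> is a \<open>p\<close>-group by the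
  existence of a non-trivial normal \<open>p\<close>-subgroup, and elements of \<open>R\<close> of order prime to \<open>p\<close> centralise it. Hence \<open>F R\<close> acts on \<open>F\<close>
  through a \<open>p\<close>-group and has a fixed point other than \<open>1\<close>. As \<open>F R\<close> is normal, its fixed points in \<open>F\<close> form
  a normal subgroup of the whole group, which must be \<open>F\<close>.
\<close>

theorem (in group) engel_subgroup_centralises_chief_factor:
  assumes fin: "finite (carrier G)" and F: "F \<lhd> G" "F \<noteq> {\<one>}"
    and chief: "\<And>E. E \<lhd> G \<Longrightarrow> E \<subseteq> F \<Longrightarrow> E = {\<one>} \<or> E = F"
    and R: "subgroup R G" and engel: "\<And>x. x \<in> R \<Longrightarrow> engel_on G F x"
    and FR: "F <#> R \<lhd> G"
  shows "R \<subseteq> centraliser F"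
proof -
  have Fs: "subgroup F G" using F(1) by (rule normal_imp_subgroup)
  have Fsub: "F \<subseteq> carrier G" using Fs by (rule subgroup.subset)
  note Fc = subgroup.mem_carrier[OF Fs] and Rc = subgroup.mem_carrier[OF R]
  have ordG: "order G > 0" using fin order_gt_0_iff_finite by blast
  have conjF: "conj_by G g f \<in> F" if "g \<in> carrier G" "f \<in> F" for g f
    using normal.inv_op_closed2[OF F(1) that] .
  have NF: "g \<in> normaliser G F" if "g \<in> carrier G" for g
    using torsion_in_normaliser[OF that pow_order_eq_1[OF that] ordG Fsub] conjF[OF that] by blast
  have CF: "subgroup (centraliser F) G" by (rule centraliser_subgroup[OF Fsub])
  show ?thesis
  proof (cases "\<forall>x\<in>R. \<forall>q k. prime (q::nat) \<longrightarrow> x [^] (q ^ k) = \<one> \<longrightarrow> x \<in> centraliser F")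
    case True
    show ?thesis
    proof
      fix x assume x: "x \<in> R"
      show "x \<in> centraliser F"
      proof (rule subgroup_contains_if_prime_power_parts[OF CF ordG _ pow_order_eq_1])
        fix i q k :: nat assume "prime q" "(x [^] i) [^] (q ^ k) = \<one>"
        moreover have "x [^] i \<in> R"
          using subgroup_int_pow_closed[OF R x, of "int i"] by (simp add: int_pow_int)
        ultimately show "x [^] i \<in> centraliser F" using True by blast
      qed (use x Rc in auto)
    qed
  next
    case False
    then obtain x p k where x: "x \<in> R" "prime (p::nat)" "x [^] (p ^ k) = \<one>" "x \<notin> centraliser F" by blast
    note p = \<open>prime p\<close>
    obtain f where "f \<in> F" "conj_by G x f \<noteq> f" using x(1,4) Rc unfolding centraliser_def by blast
    then obtain U where U: "subgroup U G" "U \<subseteq> F" "F \<subseteq> normaliser G U" "p_set G p U" "U \<noteq> {\<one>}"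
      using engel_p_element_gives_normal_p_subgroup[OF fin p Fs Rc[OF x(1)] x(3) NF[OF Rc[OF x(1)]] engel[OF x(1)]]
      by blast
    have PF: "p_set G p F"
      by (rule chief_factor_with_normal_p_subgroup[OF fin F(1) chief U])
    \<comment> \<open>For \<open>p\<^sup>a\<close> the full power of \<open>p\<close> in the group order, the order of
      \<open>r\<close> to the power \<open>p\<^sup>a\<close> is prime to \<open>p\<close>.\<close>
    have R_pow: "\<exists>a. r [^] (p ^ a) \<in> centraliser F" if r: "r \<in> R" for r
    proof -
      obtain a m where am: "order G = p ^ a * m" "\<not> p dvd m"
        using prime_power_canonical[of p "order G"] p ordG by (metis mult.commute)
      let ?r = "r [^] (p ^ a)"
      have rR: "?r \<in> R" using subgroup_int_pow_closed[OF R r, of "int (p ^ a)"] by (simp only: int_pow_int)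
      have "?r \<in> centraliser F"
      proof (rule coprime_engel_centralises[OF Fs PF])
        show "?r [^] m = \<one>" using am(1) pow_order_eq_1[OF Rc[OF r]] Rc[OF r] by (simp add: nat_pow_pow)
        show "coprime m p" using am(2) p by (metis coprime_commute prime_imp_coprime)
      qed (use rR Rc conjF engel in auto)
      then show ?thesis by blast
    qed
    let ?S = "F <#> R"
    have RN: "R \<subseteq> normaliser G F" using NF Rc by blast
    have S: "subgroup ?S G" using FR by (rule normal_imp_subgroup)
    note Sc = subgroup.mem_carrier[OF S]
    \<comment> \<open>Modulo \<open>F\<close> the element \<open>f r\<close> behaves like \<open>r\<close>, and the
      remaining factor \<open>f'\<close> has \<open>p\<close>-power order.\<close>
    have S_pow: "\<exists>a. s [^] (p ^ a) \<in> centraliser F" if s: "s \<in> ?S" for s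
    proof -
      obtain f r where fr: "f \<in> F" "r \<in> R" "s = f \<otimes> r" using s by (auto simp: set_mult_def)
      obtain a where a: "r [^] (p ^ a) \<in> centraliser F" using R_pow fr by blast
      obtain f' where f': "f' \<in> F" "s [^] (p ^ a) = f' \<otimes> r [^] (p ^ a)"
        using set_mult_pow[OF Fs R RN fr(1,2)] fr(3) by blast
      let ?r = "r [^] (p ^ a)"
      obtain b where b: "f' [^] (p ^ b) = \<one>" using PF f' by (auto simp: p_set_def)
      have rc: "?r \<in> carrier G" "f' \<in> carrier G" "s \<in> carrier G" using fr f' Rc Fc Sc[OF s] by auto
      have "conj_by G ?r f' = f'" using a f' by (simp add: centraliser_def)
      then have "?r \<otimes> f' = f' \<otimes> ?r" using rc by (metis inv_solve_right m_closed)
      then have "(f' \<otimes> ?r) [^] (p ^ b) = f' [^] (p ^ b) \<otimes> ?r [^] (p ^ b)"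
        using pow_mult_distrib rc by metis
      then have "s [^] (p ^ (a + b)) = ?r [^] (p ^ b)"
        using f' b rc by (simp add: power_add flip: nat_pow_pow)
      moreover have "?r [^] (p ^ b) \<in> centraliser F"
        using subgroup_int_pow_closed[OF CF a, of "int (p ^ b)"] by (simp only: int_pow_int)
      ultimately show ?thesis by metis
    qed
    interpret S: group "G\<lparr>carrier := ?S\<rparr>" using S by (rule subgroup_imp_group)
    interpret F: group "G\<lparr>carrier := F\<rparr>" using Fs by (rule subgroup_imp_group)
    have finF: "finite F" using fin Fsub finite_subset by blast
    define M where "M = {f \<in> F. \<exists>s\<in>carrier (G\<lparr>carrier := ?S\<rparr>). conj_by G s f \<noteq> f}"
    have "p dvd card M" unfolding M_def
    proof (rule S.p_action_moved_points[OF p finF])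
      fix s assume s: "s \<in> carrier (G\<lparr>carrier := ?S\<rparr>)"
      then obtain a where "s [^] (p ^ a) \<in> centraliser F" using S_pow by auto
      then have "\<forall>f\<in>F. conj_by G (s [^]\<^bsub>G\<lparr>carrier := ?S\<rparr>\<^esub> (p ^ a)) f = f"
        by (simp add: centraliser_def nat_pow_def)
      then show "\<exists>k. \<forall>f\<in>F. conj_by G (s [^]\<^bsub>G\<lparr>carrier := ?S\<rparr>\<^esub> (p ^ k)) f = f" by blast
    qed (use Sc Fc conjF in \<open>auto simp: word_simps\<close>)
    moreover have "p dvd card F"
    proof -
      have "p_set (G\<lparr>carrier := F\<rparr>) p (carrier (G\<lparr>carrier := F\<rparr>))"
        using PF by (simp add: p_set_def nat_pow_def)
      then obtain n where n: "card F = p ^ n" using F.order_prime_power p finF by (auto simp: order_def)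
      have "card F \<noteq> 1" using F(2) subgroup.one_closed[OF Fs] by (metis card_1_singletonE singletonD)
      then have "n \<noteq> 0" using n by (metis power_0)
      then show ?thesis using n by (simp add: dvd_power)
    qed
    ultimately have "p dvd card F - card M" by (rule dvd_diff_nat[rotated])
    define Z where "Z = {f \<in> F. \<forall>s\<in>?S. conj_by G s f = f}"
    have "Z = F - M" unfolding Z_def M_def by auto
    also have "card (F - M) = card F - card M"
      using finF by (intro card_Diff_subset) (auto simp: M_def)
    finally have "p dvd card Z" using \<open>p dvd card F - card M\<close> by simp
    have ZF: "Z \<subseteq> F" unfolding Z_def by blast
    have "Z \<noteq> {\<one>}"
    proof
      assume "Z = {\<one>}"
      then have "p dvd 1" using \<open>p dvd card Z\<close> by simp
      then show False using p prime_gt_1_nat[of p] by simp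
    qed
    have "Z \<lhd> G"
    proof (rule normal_invI)
      show "subgroup Z G"
      proof
        fix a b assume "a \<in> Z" "b \<in> Z"
        then show "a \<otimes> b \<in> Z"
          using Fc Sc hom_mult[OF conj_by_hom, of _ a b] subgroup.m_closed[OF Fs] by (simp add: Z_def)
      next
        fix a assume a: "a \<in> Z"
        have "conj_by G s (inv a) = inv a" if "s \<in> ?S" for s
        proof -
          have "conj_by G s (inv a) = inv (conj_by G s a)" using a Fc[of a] Sc[OF that] by (simp add: Z_def word_simps)
          then show ?thesis using a that by (simp add: Z_def)
        qed
        then show "inv a \<in> Z" using a subgroup.m_inv_closed[OF Fs] by (simp add: Z_def)
      qed (use Fc Sc subgroup.one_closed[OF Fs] in \<open>auto simp: Z_def\<close>)
      fix g z assume g: "g \<in> carrier G" and z: "z \<in> Z"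
      have "conj_by G s (conj_by G g z) = conj_by G g z" if s: "s \<in> ?S" for s
      proof -
        let ?s = "inv g \<otimes> s \<otimes> g"
        have "?s \<in> ?S" using normal.inv_op_closed1[OF FR g s] .
        then have "conj_by G g (conj_by G ?s z) = conj_by G g z" using z by (simp add: Z_def)
        moreover have "conj_by G s (conj_by G g z) = conj_by G g (conj_by G ?s z)"
          using g Fc[of z] ZF z Sc[OF s] by (auto simp: word_simps)
        ultimately show ?thesis by simp
      qed
      then show "conj_by G g z \<in> Z" using conjF[OF g] z by (simp add: Z_def)
    qed
    then have "Z = F" using chief ZF \<open>Z \<noteq> {\<one>}\<close> by blast
    moreover have "R \<subseteq> ?S"
    proof
      fix r assume r: "r \<in> R"
      then have "r = \<one> \<otimes> r" using Rc by simp
      then show "r \<in> ?S" using r subgroup.one_closed[OF Fs] unfolding set_mult_def by blast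
    qed
    ultimately show ?thesis using Rc by (auto simp: Z_def centraliser_def)
  qed
qed

lemma (in normal) group_hom_FactGroup: "group_hom G (G Mod H) (\<lambda>g. H #> g)"
  by (intro group_hom.intro group_hom_axioms.intro is_group factorgroup_is_group r_coset_hom_Mod)

text \<open>
  Take \<open>E\<close> of least index among the normal subgroups of finite index properly contained in \<open>K\<close>. The preimage
  \<open>D'\<close> of a normal subgroup \<open>D\<close> below \<open>K/E\<close> lies between \<open>E\<close> and \<open>K\<close>. If it is not \<open>K\<close>, its index is not
  smaller than that of \<open>E\<close>, and so it equals \<open>E\<close>.
\<close>

lemma (in group) exists_chief_quotient:
  assumes K: "K \<lhd> G" and N: "N \<lhd> G" "N \<subset> K" "finite (rcosets N)"
  shows "\<exists>E. E \<lhd> G \<and> E \<subset> K \<and> finite (carrier (G Mod E)) \<and>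
    (\<forall>D. D \<lhd> G Mod E \<longrightarrow> D \<subseteq> (\<lambda>g. E #> g) ` K \<longrightarrow> D = {\<one>\<^bsub>G Mod E\<^esub>} \<or> D = (\<lambda>g. E #> g) ` K)"
proof -
  define Q where "Q E \<longleftrightarrow> E \<lhd> G \<and> E \<subset> K \<and> finite (rcosets E)" for E
  have "Q N" using N by (simp add: Q_def)
  then obtain E where E: "Q E" "\<And>D. Q D \<Longrightarrow> card (rcosets E) \<le> card (rcosets D)"
    using ex_has_least_nat[of Q N "\<lambda>E. card (rcosets E)"] by blast
  have En: "E \<lhd> G" "E \<subset> K" "finite (rcosets E)" using E(1) by (auto simp: Q_def)
  interpret E: normal E G by (rule En(1))
  let ?pi = "\<lambda>g. E #> g"
  interpret pi: group_hom G "G Mod E" ?pi by (rule E.group_hom_FactGroup)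
  have Ks: "subgroup K G" using K by (rule normal_imp_subgroup)
  have pi_eq: "?pi g = ?pi h \<longleftrightarrow> g \<otimes> inv h \<in> E" if "g \<in> carrier G" "h \<in> carrier G" for g h
    using that E.rcos_module[OF is_group that(2,1)] repr_independence[OF _ that(2) E.subgroup_axioms, of g]
      rcos_self[OF that(1) E.subgroup_axioms] by metis
  have "D = {\<one>\<^bsub>G Mod E\<^esub>} \<or> D = ?pi ` K" if D: "D \<lhd> G Mod E" "D \<subseteq> ?pi ` K" for D
  proof -
    interpret D: normal D "G Mod E" by (rule D(1))
    define D' where "D' = {g \<in> carrier G. ?pi g \<in> D}"
    have piD: "?pi ` D' = D"
      using D(2) subgroup.mem_carrier[OF Ks] unfolding D'_def by (auto simp: image_iff)
    have "D' \<lhd> G"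
    proof (rule normal_invI)
      show "subgroup D' G"
        by standard (auto simp: D'_def simp del: mult_FactGroup one_FactGroup)
      show "conj_by G g d \<in> D'" if "g \<in> carrier G" "d \<in> D'" for g d
        using that D.inv_op_closed2[of "?pi g" "?pi d"] by (simp add: D'_def)
    qed
    have D's: "subgroup D' G" using \<open>D' \<lhd> G\<close> by (rule normal_imp_subgroup)
    have "E \<subseteq> D'"
    proof
      fix e assume e: "e \<in> E"
      then have "?pi e = \<one>\<^bsub>G Mod E\<^esub>" using E.rcos_const[OF is_group] by simp
      then show "e \<in> D'" using e by (simp add: D'_def del: one_FactGroup)
    qed
    have "D' \<subseteq> K"
    proof
      fix d assume d: "d \<in> D'"
      then have "?pi d \<in> ?pi ` K" using D(2) by (auto simp: D'_def)
      then obtain k where k: "k \<in> K" "?pi d = ?pi k" by (elim imageE)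
      have dk: "d \<in> carrier G" "k \<in> carrier G" using d k subgroup.mem_carrier[OF Ks] by (auto simp: D'_def)
      then have "d \<otimes> inv k \<in> K" using pi_eq[of d k] k(2) En(2) by blast
      then have "d \<otimes> inv k \<otimes> k \<in> K" using k(1) by (rule subgroup.m_closed[OF Ks])
      then show "d \<in> K" using dk by (simp add: m_assoc)
    qed
    show ?thesis
    proof (cases "D' = K")
      case True
      then show ?thesis using piD by blast
    next
      case False
      then have "D' \<subset> K" using \<open>D' \<subseteq> K\<close> by blast
      have D'c: "D' \<subseteq> carrier G" using D's by (rule subgroup.subset)
      have DE: "D' <#> E = D'"
      proof
        show "D' <#> E \<subseteq> D'" using \<open>E \<subseteq> D'\<close> subgroup.m_closed[OF D's] by (auto simp: set_mult_def)
        show "D' \<subseteq> D' <#> E"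
        proof
          fix d assume d: "d \<in> D'"
          then have "d = d \<otimes> \<one>" using D'c by auto
          then show "d \<in> D' <#> E" using d E.one_closed unfolding set_mult_def by blast
        qed
      qed
      have surj: "rcosets D' = (\<lambda>C. D' <#> C) ` (rcosets E)"
      proof -
        have "D' <#> (E #> g) = D' #> g" if "g \<in> carrier G" for g
          using setmult_rcos_assoc[OF D'c E.subset that] DE by simp
        then show ?thesis unfolding RCOSETS_def by auto
      qed
      then have "finite (rcosets D')" using En(3) by simp
      then have "card (rcosets E) \<le> card (rcosets D')"
        using E(2) \<open>D' \<lhd> G\<close> \<open>D' \<subset> K\<close> by (simp add: Q_def)
      then have "card ((\<lambda>C. D' <#> C) ` (rcosets E)) = card (rcosets E)"
        using surj card_image_le[OF En(3)] by (metis le_antisym)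
      then have inj: "inj_on (\<lambda>C. D' <#> C) (rcosets E)" using eq_card_imp_inj_on En(3) by blast
      have "D' \<subseteq> E"
      proof
        fix d assume d: "d \<in> D'"
        have dc: "d \<in> carrier G" using d D'c by blast
        have "D' <#> (E #> d) = D' <#> (E #> \<one>)"
        proof -
          have "D' #> d = D'" using d D's by (metis coset_join2 D'c subsetD)
          have "D' <#> (E #> d) = (D' <#> E) #> d" using setmult_rcos_assoc[OF D'c E.subset dc] .
          then show ?thesis using DE \<open>D' #> d = D'\<close> E.subset by simp
        qed
        then have "E #> d = E #> \<one>" 
          by (rule inj_onD[OF inj]) (use dc in \<open>simp_all only: rcosetsI E.subset one_closed\<close>)
        then show "d \<in> E" using pi_eq[OF dc one_closed] dc by simp
      qed
      then have "D' = E" using \<open>E \<subseteq> D'\<close> by blast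
      then have "D = ?pi ` E" using piD by simp
      also have "\<dots> = (\<lambda>_. E) ` E" using E.rcos_const[OF is_group] by (intro image_cong) auto
      also have "\<dots> = {\<one>\<^bsub>G Mod E\<^esub>}"
        using E.one_closed by (subst image_constant[of \<one>]) simp_all
      finally show ?thesis by blast
    qed
  qed
  then show ?thesis using En by (auto simp: FactGroup_def)
qed

section \<open>Finite Engel groups\<close>

lemma (in group) commutator_subgroup_normal:
  assumes A: "A \<lhd> G"
  shows "commutator_subgroup G A (carrier G) \<lhd> G \<and> commutator_subgroup G A (carrier G) \<subseteq> A"
proof
  interpret A: normal A G by (rule A)
  let ?C = "{inv a \<otimes> inv b \<otimes> a \<otimes> b | a b. a \<in> A \<and> b \<in> carrier G}"
  have C: "?C \<subseteq> A"
  proof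
    fix c assume "c \<in> ?C"
    then obtain a b where ab: "a \<in> A" "b \<in> carrier G" "c = inv a \<otimes> inv b \<otimes> a \<otimes> b" by blast
    then have "c = inv a \<otimes> (inv b \<otimes> a \<otimes> b)" by (simp add: m_assoc)
    then show "c \<in> A" using ab A.inv_op_closed1 by simp
  qed
  show "commutator_subgroup G A (carrier G) \<subseteq> A"
    unfolding commutator_subgroup_def using generate_subgroup_incl[OF C A.subgroup_axioms] .
  show "commutator_subgroup G A (carrier G) \<lhd> G"
    unfolding commutator_subgroup_def
  proof (rule normal_generateI)
    show "?C \<subseteq> carrier G" using C A.subset by blast
    fix h g assume "h \<in> ?C" and g: "g \<in> carrier G"
    then obtain a b where ab: "a \<in> A" "b \<in> carrier G" "h = inv a \<otimes> inv b \<otimes> a \<otimes> b" by blast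
    let ?a = "conj_by G g a" and ?b = "conj_by G g b"
    have "conj_by G g h = inv ?a \<otimes> inv ?b \<otimes> ?a \<otimes> ?b" using ab g by (simp add: word_simps)
    moreover have "?a \<in> A" "?b \<in> carrier G" using ab g A.inv_op_closed2 by simp_all
    ultimately show "conj_by G g h \<in> ?C" by blast
  qed
qed

lemma (in group) lower_central_normal: "lower_central G n \<lhd> G"
  by (induction n) (use commutator_subgroup_normal normal_self in auto)

text \<open>
  This is Zorn's theorem. The lower central series becomes stationary at some \<open>K\<close>. If \<open>K\<close> is not trivial, there
  is a chief factor \<open>K/E\<close>; the whole group centralises it, so \<open>[K,G] \<subseteq> E \<subset> K\<close>, contrary to \<open>[K,G] = K\<close>.
\<close>

theorem (in group) finite_engel_group_is_nilpotent:
  assumes fin: "finite (carrier G)"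
    and engel: "\<And>x. x \<in> carrier G \<Longrightarrow> engel_on G (carrier G) x"
  shows "nilpotent_group G"
proof -
  obtain n where n: "\<And>m. card (lower_central G n) \<le> card (lower_central G m)"
    using ex_has_least_nat[of "\<lambda>_. True" 0 "\<lambda>n. card (lower_central G n)"] by blast
  define K where "K = lower_central G n"
  have K: "K \<lhd> G" unfolding K_def by (rule lower_central_normal)
  have Ks: "subgroup K G" using K by (rule normal_imp_subgroup)
  have Ksub: "K \<subseteq> carrier G" using Ks by (rule subgroup.subset)
  have comm: "commutator_subgroup G K (carrier G) = K"
  proof (rule card_seteq)
    show "finite K" using Ksub fin finite_subset by blast
    show "card K \<le> card (commutator_subgroup G K (carrier G))"
      using n[of "Suc n"] unfolding K_def by simp
  qed (use commutator_subgroup_normal[OF K] in blast)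
  have "K = {\<one>}"
  proof (rule ccontr)
    assume "K \<noteq> {\<one>}"
    then have "{\<one>} \<subset> K" using subgroup.one_closed[OF Ks] by blast
    moreover have "finite (rcosets {\<one>})" using fin by (simp add: RCOSETS_def)
    ultimately obtain E where E: "E \<lhd> G" "E \<subset> K" "finite (carrier (G Mod E))"
      and chief: "\<And>D. D \<lhd> G Mod E \<Longrightarrow> D \<subseteq> (\<lambda>g. E #> g) ` K
        \<Longrightarrow> D = {\<one>\<^bsub>G Mod E\<^esub>} \<or> D = (\<lambda>g. E #> g) ` K"
      using exists_chief_quotient[OF K one_is_normal] by blast
    interpret E: normal E G by (rule E(1))
    let ?Q = "G Mod E" and ?pi = "\<lambda>g. E #> g"
    interpret pi: group_hom G ?Q ?pi by (rule E.group_hom_FactGroup)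
    have onto: "?pi ` carrier G = carrier ?Q" by (simp add: carrier_FactGroup)
    let ?F = "?pi ` K"
    have F: "?F \<lhd> ?Q" using normal.surj_hom_normal_subgroup[OF K pi.group_hom_axioms onto] .
    have Fs: "subgroup ?F ?Q" using F by (rule normal_imp_subgroup)
    have "?F \<noteq> {\<one>\<^bsub>?Q\<^esub>}"
    proof
      assume eq: "?F = {\<one>\<^bsub>?Q\<^esub>}"
      have "k \<in> E" if "k \<in> K" for k
      proof -
        have "?pi k = E" using eq that by auto
        then show ?thesis using rcos_self[of k E] that Ksub E.subgroup_axioms by auto
      qed
      then show False using E(2) by blast
    qed
    moreover have "?F <#>\<^bsub>?Q\<^esub> carrier ?Q = carrier ?Q"
    proof
      show "?F <#>\<^bsub>?Q\<^esub> carrier ?Q \<subseteq> carrier ?Q"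
        using pi.H.set_mult_closed subgroup.subset[OF Fs] by blast
      show "carrier ?Q \<subseteq> ?F <#>\<^bsub>?Q\<^esub> carrier ?Q"
      proof
        fix q assume q: "q \<in> carrier ?Q"
        then have "q = \<one>\<^bsub>?Q\<^esub> \<otimes>\<^bsub>?Q\<^esub> q" by (rule pi.H.l_one[symmetric])
        then show "q \<in> ?F <#>\<^bsub>?Q\<^esub> carrier ?Q"
          using q subgroup.one_closed[OF Fs] unfolding set_mult_def by blast
      qed
    qed
    then have "?F <#>\<^bsub>?Q\<^esub> carrier ?Q \<lhd> ?Q" using pi.H.normal_self by simp
    moreover have "engel_on ?Q ?F q" if q: "q \<in> carrier ?Q" for q
    proof -
      obtain x where x: "x \<in> carrier G" "q = ?pi x" using q onto by blast
      have "engel_on G K x" using engel[OF x(1)] Ksub by (auto simp: engel_on_def)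
      then show ?thesis using pi.engel_on_image[OF x(1) Ksub] x(2) by simp
    qed
    ultimately have cent: "carrier ?Q \<subseteq> pi.H.centraliser ?F"
      by (intro pi.H.engel_subgroup_centralises_chief_factor[OF E(3) F _ chief pi.H.subgroup_self])
    have "inv a \<otimes> inv b \<otimes> a \<otimes> b \<in> E" if ab: "a \<in> K" "b \<in> carrier G" for a b
    proof -
      have ac: "a \<in> carrier G" using ab Ksub by blast
      have "?pi (inv b) \<in> pi.H.centraliser ?F" using cent pi.hom_closed ab by blast
      then have "conj_by ?Q (?pi (inv b)) (?pi a) = ?pi a" using ab(1) by (simp add: pi.H.centraliser_def)
      moreover have "conj_by ?Q (?pi (inv b)) (?pi a) = ?pi (inv b \<otimes> a \<otimes> inv (inv b))"
        using ac ab by (simp only: pi.hom_mult pi.hom_inv inv_closed m_closed)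
      ultimately have "?pi (inv b \<otimes> a \<otimes> b) = ?pi a" using ab by simp
      then have "?pi (inv a) \<otimes>\<^bsub>?Q\<^esub> ?pi (inv b \<otimes> a \<otimes> b) = ?pi (inv a) \<otimes>\<^bsub>?Q\<^esub> ?pi a" by simp
      then have "?pi (inv a \<otimes> (inv b \<otimes> a \<otimes> b)) = ?pi (inv a \<otimes> a)"
        using ac ab by (simp only: pi.hom_mult inv_closed m_closed)
      then have "?pi (inv a \<otimes> inv b \<otimes> a \<otimes> b) = E" using ac ab E.subset by (simp add: m_assoc)
      then show ?thesis using rcos_self[of "inv a \<otimes> inv b \<otimes> a \<otimes> b" E] ac ab E.subgroup_axioms by simp
    qed
    then have "commutator_subgroup G K (carrier G) \<subseteq> E"
      unfolding commutator_subgroup_def by (intro generate_subgroup_incl[OF _ E.subgroup_axioms]) auto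
    then show False using comm E(2) by blast
  qed
  then show ?thesis unfolding nilpotent_group_def K_def using is_group by blast
qed

section \<open>Finite Engel actions on locally graded groups\<close>

lemma finite_image_if_determined:
  assumes "finite (f ` A)" "\<And>a b. a \<in> A \<Longrightarrow> b \<in> A \<Longrightarrow> f a = f b \<Longrightarrow> g a = g b"
  shows "finite (g ` A)"
proof -
  have "g a \<in> (\<lambda>y. g (inv_into A f y)) ` f ` A" if "a \<in> A" for a
    using that assms(2)[of "inv_into A f (f a)" a] by (intro image_eqI[of _ _ "f a"]) (auto simp: inv_into_into f_inv_into_f)
  then show ?thesis using assms(1) by (meson finite_imageI finite_subset image_subsetI)
qed

context group
begin

lemma group_hom_subgroup_inclusion:
  assumes "subgroup M G" shows "group_hom (G\<lparr>carrier := M\<rparr>) G (\<lambda>x. x)"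
  using assms by (intro group_hom.intro group_hom_axioms.intro is_group subgroup_imp_group)
    (auto simp: hom_def dest: subgroup.mem_carrier)

lemma engel_on_subgroup_iff:
  assumes M: "subgroup M G" and x: "x \<in> M" and A: "A \<subseteq> M"
  shows "engel_on (G\<lparr>carrier := M\<rparr>) A x \<longleftrightarrow> engel_on G A x"
proof -
  interpret i: group_hom "G\<lparr>carrier := M\<rparr>" G "\<lambda>x. x" by (rule group_hom_subgroup_inclusion[OF M])
  have "iter_comm (G\<lparr>carrier := M\<rparr>) a n (conj_by (G\<lparr>carrier := M\<rparr>) x) = iter_comm G a n (conj_by G x)"
    if "a \<in> A" for a n
    using i.hom_iter_comm[of x a n] x A that by auto
  then show ?thesis unfolding engel_on_def by simp
qed

text \<open>
  Conjugation by \<open>h\<close> is an automorphism that preserves \<open>T\<close>.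
\<close>

lemma engel_on_conj:
  assumes T: "subgroup T G" and h: "h \<in> T" and x: "x \<in> carrier G" and engel: "engel_on G T x"
  shows "engel_on G T (inv h \<otimes> x \<otimes> h)"
  unfolding engel_on_def
proof
  fix t assume t: "t \<in> T"
  have c: "h \<in> carrier G" "t \<in> carrier G" using h t T subgroup.mem_carrier by metis+
  interpret c: group_hom G G "conj_by G (inv h)" using conj_by_hom[of "inv h"] c by unfold_locales simp
  define t' where "t' = conj_by G h t"
  have t': "t' \<in> T" "t' \<in> carrier G" "conj_by G (inv h) t' = t"
    using h t T c by (simp_all add: t'_def subgroup.m_closed subgroup.m_inv_closed word_simps)
  obtain n where n: "iter_comm G t' n (conj_by G x) = \<one>" using engel t'(1) unfolding engel_on_def by blast
  have "iter_comm G (conj_by G (inv h) t') n (conj_by G (conj_by G (inv h) x))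
      = conj_by G (inv h) (iter_comm G t' n (conj_by G x))"
    using c.hom_iter_comm[OF x t'(2), of n] by (simp only:)
  then have "iter_comm G t n (conj_by G (inv h \<otimes> x \<otimes> h)) = \<one>"
    unfolding t'(3) n using c by simp
  then show "\<exists>n. iter_comm G t n (conj_by G (inv h \<otimes> x \<otimes> h)) = \<one>" by blast
qed

lemma torsion_in_normaliser_generate:
  assumes x: "x \<in> carrier G" "x [^] (n::nat) = \<one>" "n > 0" and A: "A \<subseteq> carrier G"
    and sub: "\<And>a. a \<in> A \<Longrightarrow> conj_by G x a \<in> generate G A"
  shows "x \<in> normaliser G (generate G A)"
proof (rule torsion_in_normaliser[OF x])
  show "generate G A \<subseteq> carrier G" using generate_incl[OF A] .
  interpret f: group_hom G G "conj_by G x" using conj_by_hom[OF x(1)] by unfold_locales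
  have "generate G (conj_by G x ` A) \<subseteq> generate G A"
    using sub by (intro generate_subgroup_incl[OF _ generate_is_subgroup[OF A]]) auto
  then have "conj_by G x ` generate G A \<subseteq> generate G A" using f.generate_img[OF A] by simp
  then show "conj_by G x a \<in> generate G A" if "a \<in> generate G A" for a using that by blast
qed

lemma subgroup_subset_normaliser:
  assumes U: "subgroup U G" shows "U \<subseteq> normaliser G U"
proof
  fix u assume u: "u \<in> U"
  note Uc = subgroup.mem_carrier[OF U]
  have "a \<in> conj_by G u ` U" if a: "a \<in> U" for a
  proof (rule image_eqI)
    show "a = conj_by G u (conj_by G (inv u) a)" using u a Uc by (simp add: word_simps)
  qed (use u a U in \<open>simp add: subgroup.m_closed subgroup.m_inv_closed Uc\<close>)
  moreover have "conj_by G u a \<in> U" if "a \<in> U" for a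
    using u that U by (simp add: subgroup.m_closed subgroup.m_inv_closed)
  ultimately show "u \<in> normaliser G U" using u Uc by (auto simp: normaliser_def)
qed

lemma set_mult_subset_subgroup:
  "subgroup M G \<Longrightarrow> A \<subseteq> M \<Longrightarrow> B \<subseteq> M \<Longrightarrow> A <#> B \<subseteq> M"
  by (auto simp: set_mult_def intro: subgroup.m_closed)

lemma subset_set_mult:
  assumes U: "subgroup U G" and V: "subgroup V G"
  shows "U \<subseteq> U <#> V" "V \<subseteq> U <#> V"
proof -
  show "U \<subseteq> U <#> V"
  proof
    fix u assume u: "u \<in> U"
    then have "u = u \<otimes> \<one>" using subgroup.mem_carrier[OF U] by simp
    then show "u \<in> U <#> V" using u subgroup.one_closed[OF V] unfolding set_mult_def by blast
  qed
  show "V \<subseteq> U <#> V"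
  proof
    fix v assume v: "v \<in> V"
    then have "v = \<one> \<otimes> v" using subgroup.mem_carrier[OF V] by simp
    then show "v \<in> U <#> V" using v subgroup.one_closed[OF U] unfolding set_mult_def by blast
  qed
qed

text \<open>
  The intersection of the finitely many \<open>V\<close>-conjugates of \<open>N0\<close> is normal in \<open>L V\<close>. Its index is finite because
  the coset of \<open>l \<in> L\<close> modulo the intersection is determined by the cosets of the elements \<open>v l v\<^sup>-\<close> modulo \<open>N0\<close>.
\<close>

lemma finite_index_invariant_core:
  assumes L: "subgroup L G" and V: "subgroup V G" "finite V" "V \<subseteq> normaliser G L"
    and N0: "N0 \<lhd> G\<lparr>carrier := L\<rparr>" "N0 \<noteq> L" "finite (rcosets\<^bsub>G\<lparr>carrier := L\<rparr>\<^esub> N0)"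
  shows "\<exists>N. N \<lhd> G\<lparr>carrier := L <#> V\<rparr> \<and> N \<subset> L \<and> finite (rcosets\<^bsub>G\<lparr>carrier := L <#> V\<rparr>\<^esub> N)"
proof -
  note Lc = subgroup.mem_carrier[OF L] and Vc = subgroup.mem_carrier[OF V(1)]
  define M where "M = L <#> V"
  have M: "subgroup M G" unfolding M_def by (rule set_mult_subgroup[OF L V(1,3)])
  note Mc = subgroup.mem_carrier[OF M]
  interpret L: group "G\<lparr>carrier := L\<rparr>" using L by (rule subgroup_imp_group)
  interpret M: group "G\<lparr>carrier := M\<rparr>" using M by (rule subgroup_imp_group)
  interpret N0: normal N0 "G\<lparr>carrier := L\<rparr>" by (rule N0(1))
  have N0L: "N0 \<subseteq> L" using N0.subset by simp
  have N0s: "subgroup N0 G" using incl_subgroup[OF L N0.subgroup_axioms] .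
  have N0_conj: "conj_by G l a \<in> N0" if "l \<in> L" "a \<in> N0" for l a
    using N0.inv_op_closed2[of l a] that m_inv_consistent[OF L] by simp
  have VL: "conj_by G v l \<in> L" if "v \<in> V" "l \<in> L" for v l
    by (rule normaliser_conj_closed) (use that V(3) in auto)
  define N where "N = {l \<in> L. \<forall>v\<in>V. conj_by G v l \<in> N0}"
  have NL: "N \<subseteq> L" unfolding N_def by blast
  have N: "subgroup N G"
  proof
    fix a b assume ab: "a \<in> N" "b \<in> N"
    then have "conj_by G v (a \<otimes> b) = conj_by G v a \<otimes> conj_by G v b" if "v \<in> V" for v
      using that Lc NL Vc by (intro hom_mult[OF conj_by_hom]) auto
    then show "a \<otimes> b \<in> N" using ab by (simp add: N_def subgroup.m_closed[OF L] subgroup.m_closed[OF N0s])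
  next
    fix a assume a: "a \<in> N"
    then have "conj_by G v (inv a) = inv (conj_by G v a)" if "v \<in> V" for v
      using that Lc NL Vc by (auto simp: word_simps)
    then show "inv a \<in> N" using a by (simp add: N_def subgroup.m_inv_closed[OF L] subgroup.m_inv_closed[OF N0s])
  qed (use Vc Lc subgroup.one_closed[OF L] subgroup.one_closed[OF N0s] in \<open>auto simp: N_def\<close>)
  have N_conj: "conj_by G m a \<in> N" if m: "m \<in> M" and a: "a \<in> N" for m a
  proof -
    obtain l u where lu: "l \<in> L" "u \<in> V" "m = l \<otimes> u" using m unfolding M_def set_mult_def by blast
    have ac: "a \<in> carrier G" "a \<in> L" using a NL Lc by auto
    have lc: "l \<in> carrier G" "u \<in> carrier G" using lu Lc Vc by auto
    have "conj_by G v (conj_by G m a) \<in> N0" if v: "v \<in> V" for v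
    proof -
      have "conj_by G (v \<otimes> u) a \<in> N0" using a v lu subgroup.m_closed[OF V(1)] by (simp add: N_def)
      then have "conj_by G (conj_by G v l) (conj_by G (v \<otimes> u) a) \<in> N0" by (rule N0_conj[OF VL[OF v lu(1)]])
      moreover have "conj_by G v (conj_by G m a) = conj_by G (conj_by G v l) (conj_by G (v \<otimes> u) a)"
        using lu(3) lc ac Vc[OF v] by (simp add: word_simps)
      ultimately show ?thesis by simp
    qed
    moreover have "conj_by G m a = conj_by G l (conj_by G u a)" using lu(3) lc ac by (simp add: word_simps)
    then have "conj_by G m a \<in> L"
      using lu VL[OF lu(2) ac(2)] by (simp add: subgroup.m_closed[OF L] subgroup.m_inv_closed[OF L])
    ultimately show ?thesis by (simp add: N_def)
  qed
  have LM: "L \<subseteq> M" unfolding M_def by (rule subset_set_mult[OF L V(1)])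
  have "N \<lhd> G\<lparr>carrier := M\<rparr>"
  proof (rule M.normal_invI)
    show "subgroup N (G\<lparr>carrier := M\<rparr>)" using subgroup_incl[OF N M] NL LM by blast
  qed (use N_conj m_inv_consistent[OF M] in auto)
  moreover have "N \<subset> L"
  proof -
    have "N \<subseteq> N0"
    proof
      fix a assume a: "a \<in> N"
      then have "conj_by G \<one> a \<in> N0" using subgroup.one_closed[OF V(1)] unfolding N_def by blast
      then show "a \<in> N0" using a NL Lc by auto
    qed
    then show ?thesis using N0L N0(2) NL by blast
  qed
  moreover have "finite (rcosets\<^bsub>G\<lparr>carrier := M\<rparr>\<^esub> N)"
  proof -
    define f where "f l = (\<lambda>v\<in>V. N0 #> conj_by G v l)" for l
    have cosets: "rcosets\<^bsub>G\<lparr>carrier := L\<rparr>\<^esub> N0 = (\<lambda>l. N0 #> l) ` L" by (auto simp: RCOSETS_def)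
    have "f ` L \<subseteq> V \<rightarrow>\<^sub>E rcosets\<^bsub>G\<lparr>carrier := L\<rparr>\<^esub> N0"
      using VL unfolding cosets f_def by auto
    then have "finite (f ` L)" using finite_PiE[OF V(2)] N0(3) finite_subset by meson
    moreover have "N #> a = N #> b" if ab: "a \<in> L" "b \<in> L" "f a = f b" for a b
    proof -
      have c: "a \<in> carrier G" "b \<in> carrier G" using ab Lc by auto
      have "conj_by G v (a \<otimes> inv b) \<in> N0" if v: "v \<in> V" for v
      proof -
        have vc: "conj_by G v a \<in> carrier G" "conj_by G v b \<in> carrier G" using c Vc[OF v] by auto
        have "N0 #> conj_by G v a = N0 #> conj_by G v b" using fun_cong[OF ab(3), of v] v by (simp add: f_def)
        then have "conj_by G v a \<in> N0 #> conj_by G v b" using rcos_self[OF vc(1) N0s] by simp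
        then have "conj_by G v a \<otimes> inv (conj_by G v b) \<in> N0"
          using subgroup.rcos_module_imp[OF N0s is_group vc(2)] by blast
        moreover have "conj_by G v a \<otimes> inv (conj_by G v b) = conj_by G v (a \<otimes> inv b)"
          using c Vc[OF v] by (simp add: word_simps)
        ultimately show ?thesis by simp
      qed
      then have "a \<otimes> inv b \<in> N" using ab by (simp add: N_def subgroup.m_closed[OF L] subgroup.m_inv_closed[OF L])
      then have "a \<in> N #> b" using subgroup.rcos_module_rev[OF N is_group c(2,1)] by simp
      then show ?thesis using repr_independence[OF _ c(2) N] by simp
    qed
    ultimately have fin: "finite ((\<lambda>l. N #> l) ` L)" by (rule finite_image_if_determined)
    have "rcosets\<^bsub>G\<lparr>carrier := M\<rparr>\<^esub> N \<subseteq> (\<Union>v\<in>V. (\<lambda>C. C #> v) ` (\<lambda>l. N #> l) ` L)"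
    proof
      fix C assume "C \<in> rcosets\<^bsub>G\<lparr>carrier := M\<rparr>\<^esub> N"
      then obtain l v where lv: "l \<in> L" "v \<in> V" "C = N #> (l \<otimes> v)" by (auto simp: RCOSETS_def M_def set_mult_def)
      then have "C = N #> l #> v" using coset_mult_assoc[of N l v] NL Lc Vc by auto
      then show "C \<in> (\<Union>v\<in>V. (\<lambda>C. C #> v) ` (\<lambda>l. N #> l) ` L)" using lv by blast
    qed
    then show ?thesis using fin V(2) by (meson finite_UN_I finite_imageI finite_subset)
  qed
  ultimately show ?thesis unfolding M_def by blast
qed

end

text \<open>
  The induction step of the argument that \<open>R = [R,y]\<close> centralises \<open>T\<close>: if \<open>R\<close> centralises \<open>[h,y]\<close>, then it
  centralises \<open>h\<close>. Below, \<open>xh x\<close> is the conjugate of \<open>x\<close> by \<open>h\<close>, the map \<open>c\<close> is \<open>x \<mapsto> [h,x]\<close>, and \<open>L\<close> is the subgroup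
  generated by its values. If \<open>L\<close> is not trivial, it has a chief factor \<open>F\<close>, on which \<open>c\<close> induces a map \<open>cb\<close>.
  This map is a homomorphism on \<open>R\<close> that is constant on orbits of \<open>y\<close>, hence trivial on \<open>R = [R,y]\<close>, although
  its values generate \<open>F\<close>.
\<close>

lemma (in group) centralises_if_centralises_commutator:
  assumes T: "subgroup T G" and lg: "locally_graded (G\<lparr>carrier := T\<rparr>)"
    and H: "subgroup H G" "finite H" "H \<subseteq> normaliser G T"
    and engel: "\<And>x. x \<in> H \<Longrightarrow> engel_on G T x"
    and R: "subgroup R G" "R \<subseteq> H" and y: "y \<in> H" "\<And>x. x \<in> R \<Longrightarrow> conj_by G y x \<in> R"
    and comm: "generate G ((\<lambda>x. inv x \<otimes> conj_by G y x) ` R) = R"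
    and h: "h \<in> T" and hk: "\<And>x. x \<in> R \<Longrightarrow> conj_by G x (inv h \<otimes> conj_by G y h) = inv h \<otimes> conj_by G y h"
    and x: "x \<in> R"
  shows "conj_by G x h = h"
proof -
  note Tc = subgroup.mem_carrier[OF T] and Hc = subgroup.mem_carrier[OF H(1)] and Rc = subgroup.mem_carrier[OF R(1)]
  note Tcl = subgroup.m_closed[OF T] subgroup.m_inv_closed[OF T]
  note Rcl = subgroup.m_closed[OF R(1)] subgroup.m_inv_closed[OF R(1)] subgroup.one_closed[OF R(1)]
  have hc: "h \<in> carrier G" "y \<in> carrier G" using h Tc y Hc by auto
  have finR: "finite R" using R(2) H(2) finite_subset by blast
  have ordH: "x [^] card H = \<one>" if "x \<in> H" for x
  proof -
    interpret K: group "G\<lparr>carrier := H\<rparr>" using H(1) by (rule subgroup_imp_group)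
    show ?thesis using K.pow_order_eq_1[of x] that by (simp add: order_def nat_pow_def)
  qed
  have cardH: "card H > 0" using H subgroup.one_closed[OF H(1)] card_gt_0_iff by blast
  define xh where "xh x = inv h \<otimes> x \<otimes> h" for x
  define c where "c x = xh x \<otimes> inv x" for x
  define w where "w = xh y"
  define k where "k = inv h \<otimes> conj_by G y h"
  have xh_pow: "xh x [^] (n::nat) = xh (x [^] n)" if "x \<in> carrier G" for x n
    using conj_by_pow[of "inv h" x n] that hc by (simp add: xh_def)
  have xhc: "xh x \<in> carrier G" if "x \<in> carrier G" for x using that hc by (simp add: xh_def)
  have cc: "c x \<in> carrier G" if "x \<in> carrier G" for x using that xhc by (simp add: c_def)
  have wc: "w \<in> carrier G" using xhc hc by (simp add: w_def)
  have conjT: "conj_by G x t \<in> T" if "x \<in> H" "t \<in> T" for x t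
    by (rule normaliser_conj_closed) (use that H(3) in auto)
  have cT: "c x \<in> T" if "x \<in> R" for x
  proof -
    have "c x = inv h \<otimes> conj_by G x h" using that Rc hc by (simp add: c_def xh_def word_simps)
    then show ?thesis using conjT[of x h] that R(2) h Tcl by auto
  qed
  have kc: "k \<in> carrier G" using hc by (simp add: k_def)
  have w_eq: "w = k \<otimes> y" using hc by (simp add: w_def xh_def k_def word_simps)
  \<comment> \<open>Because \<open>w = k y\<close> and \<open>R\<close> commutes with \<open>k\<close>, both
    \<open>w\<close> and \<open>y\<close> act in the same way on \<open>R\<close>.\<close>
  have w_R: "conj_by G w x = conj_by G y x" if x: "x \<in> R" for x
  proof -
    let ?x = "conj_by G y x"
    have xR: "?x \<in> R" "?x \<in> carrier G" using y(2)[OF x] Rc by auto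
    have "conj_by G ?x k = k" using hk[OF xR(1)] unfolding k_def .
    then have "?x \<otimes> k = k \<otimes> ?x" using xR(2) kc inv_solve_right by (metis m_closed)
    then have "conj_by G k ?x = ?x" using xR(2) kc by (simp add: m_assoc flip: \<open>?x \<otimes> k = k \<otimes> ?x\<close>)
    moreover have "conj_by G w x = conj_by G k ?x"
      unfolding w_eq using conj_by_conj_by[OF kc hc(2) Rc[OF x]] by simp
    ultimately show ?thesis by simp
  qed
  have conj_c: "conj_by G z (c x) = inv (c z) \<otimes> c (z \<otimes> x)" if "z \<in> R" "x \<in> R" for z x
    using that Rc hc by (simp add: c_def xh_def word_simps)
  have w_c: "conj_by G w (c x) = c (conj_by G y x)" if x: "x \<in> R" for x
  proof -
    have xc: "x \<in> carrier G" "xh x \<in> carrier G" using x Rc xhc by auto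
    have "conj_by G w (c x) = conj_by G w (xh x) \<otimes> inv (conj_by G w x)"
      using xc wc by (simp add: c_def word_simps)
    also have "conj_by G w (xh x) = xh (conj_by G y x)"
      using xc hc by (simp add: w_def xh_def word_simps)
    finally show ?thesis using w_R[OF x] by (simp add: c_def)
  qed
  define A where "A = c ` R"
  define L where "L = generate G A"
  have A: "A \<subseteq> T" "A \<subseteq> carrier G" "finite A" using cT Tc finR by (auto simp: A_def)
  have L: "subgroup L G" unfolding L_def by (rule generate_is_subgroup[OF A(2)])
  have LT: "L \<subseteq> T" unfolding L_def by (rule generate_subgroup_incl[OF A(1) T])
  have cL: "c x \<in> L" if "x \<in> R" for x using that by (auto simp: L_def A_def intro: generate.incl)
  have "L = {\<one>}"
  proof (rule ccontr)
    assume L1: "L \<noteq> {\<one>}"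
    have RL: "R \<subseteq> normaliser G L"
    proof
      fix z assume z: "z \<in> R"
      show "z \<in> normaliser G L" unfolding L_def
      proof (rule torsion_in_normaliser_generate[OF Rc[OF z] ordH cardH A(2)])
        fix a assume "a \<in> A"
        then obtain x where x: "x \<in> R" "a = c x" by (auto simp: A_def)
        have "inv (c z) \<otimes> c (z \<otimes> x) \<in> L"
          using cL z x Rcl L by (simp add: subgroup.m_closed subgroup.m_inv_closed)
        then show "conj_by G z a \<in> generate G A" using conj_c[OF z x(1)] x(2) by (simp add: L_def)
      qed (use z R in auto)
    qed
    have w_ord: "w [^] card H = \<one>"
      using xh_pow[OF hc(2), of "card H"] ordH[OF y(1)] hc by (simp add: w_def xh_def)
    have wL: "w \<in> normaliser G L" unfolding L_def
    proof (rule torsion_in_normaliser_generate[OF wc w_ord cardH A(2)])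
      fix a assume "a \<in> A"
      then obtain x where x: "x \<in> R" "a = c x" by (auto simp: A_def)
      then show "conj_by G w a \<in> generate G A" using w_c[OF x(1)] cL[OF y(2)[OF x(1)]] by (simp add: L_def)
    qed
    have Rsub: "R \<subseteq> carrier G" and Lsub: "L \<subseteq> carrier G" using R(1) L subgroup.subset by auto
    have wR: "w \<in> normaliser G R"
      by (rule torsion_in_normaliser[OF wc w_ord cardH Rsub]) (use w_R y(2) in simp)
    define W where "W = generate G {w}"
    have W: "subgroup W G" unfolding W_def using generate_is_subgroup wc by simp
    have wW: "w \<in> W" by (simp add: W_def generate.incl)
    have finW: "finite W"
    proof -
      interpret f: group_hom G G "conj_by G (inv h)" using conj_by_hom[of "inv h"] hc by unfold_locales simp
      have "{w} = conj_by G (inv h) ` {y}" using hc by (simp add: w_def xh_def)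
      then have "W = conj_by G (inv h) ` generate G {y}" using f.generate_img[of "{y}"] hc by (simp add: W_def)
      moreover have "generate G {y} \<subseteq> H" using generate_subgroup_incl[OF _ H(1)] y by simp
      ultimately show ?thesis using H(2) finite_subset by blast
    qed
    have WR: "W \<subseteq> normaliser G R" and WL: "W \<subseteq> normaliser G L"
      using wR wL generate_subgroup_incl[OF _ normaliser_subgroup] Rsub Lsub unfolding W_def by auto
    \<comment> \<open>The finite group \<open>V\<close> normalises \<open>L\<close>, so \<open>L\<close> has finite
      index in \<open>M = L V\<close>.\<close>
    define V where "V = R <#> W"
    have V: "subgroup V G" unfolding V_def by (rule set_mult_subgroup[OF R(1) W WR])
    have finV: "finite V" unfolding V_def set_mult_def using finR finW by simp
    have RV: "R \<subseteq> V" and WV: "W \<subseteq> V" unfolding V_def using subset_set_mult[OF R(1) W] by auto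
    have VL: "V \<subseteq> normaliser G L"
      unfolding V_def by (rule set_mult_subset_subgroup[OF normaliser_subgroup[OF Lsub] RL WL])
    define M where "M = L <#> V"
    have M: "subgroup M G" unfolding M_def by (rule set_mult_subgroup[OF L V VL])
    have LM: "L \<subseteq> M" and VM: "V \<subseteq> M" unfolding M_def using subset_set_mult[OF L V] by auto
    have genT: "generate (G\<lparr>carrier := T\<rparr>) A = L" using generate_consistent[OF A(1) T] by (simp add: L_def)
    obtain N0 where N0: "N0 \<lhd> G\<lparr>carrier := L\<rparr>" "N0 \<noteq> L" "finite (rcosets\<^bsub>G\<lparr>carrier := L\<rparr>\<^esub> N0)"
      using lg A(1,3) L1 genT unfolding locally_graded_def by auto
    obtain N where N: "N \<lhd> G\<lparr>carrier := M\<rparr>" "N \<subset> L" "finite (rcosets\<^bsub>G\<lparr>carrier := M\<rparr>\<^esub> N)"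
      using finite_index_invariant_core[OF L V finV VL N0] unfolding M_def by blast
    have normal_in_M: "U \<lhd> G\<lparr>carrier := M\<rparr>" if U: "subgroup U G" "U \<subseteq> M" "M \<subseteq> normaliser G U" for U
    proof -
      interpret M: group "G\<lparr>carrier := M\<rparr>" using M by (rule subgroup_imp_group)
      show ?thesis
      proof (rule M.normal_invI)
        show "subgroup U (G\<lparr>carrier := M\<rparr>)" using subgroup_incl[OF U(1) M U(2)] .
        show "conj_by (G\<lparr>carrier := M\<rparr>) m u \<in> U" if "m \<in> carrier (G\<lparr>carrier := M\<rparr>)" "u \<in> U" for m u
          using normaliser_conj_closed[of m U u] that U(3) m_inv_consistent[OF M] by auto
      qed
    qed
    have LN: "L \<lhd> G\<lparr>carrier := M\<rparr>"
      using set_mult_subset_subgroup[OF normaliser_subgroup[OF Lsub] subgroup_subset_normaliser[OF L] VL]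
      by (intro normal_in_M[OF L LM]) (simp add: M_def)
    \<comment> \<open>The chief factor theorem is going to be applied to \<open>R\<close> and to \<open>h\<^sup>- R
      h\<close>; the product of either with \<open>L\<close> is the subgroup \<open>S\<close>, which
      is normal in \<open>M\<close>.\<close>
    define S where "S = L <#> R"
    have S: "subgroup S G" unfolding S_def by (rule set_mult_subgroup[OF L R(1) RL])
    have Ssub: "S \<subseteq> carrier G" using S by (rule subgroup.subset)
    have LS: "L \<subseteq> S" and RS: "R \<subseteq> S" unfolding S_def using subset_set_mult[OF L R(1)] by auto
    have SM: "S \<subseteq> M" unfolding S_def using LM RV VM by (intro set_mult_subset_subgroup[OF M]) auto
    have wS: "w \<in> normaliser G S"
    proof (rule torsion_in_normaliser[OF wc w_ord cardH Ssub])
      fix a assume "a \<in> S"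
      then obtain l x where lx: "l \<in> L" "x \<in> R" "a = l \<otimes> x" by (auto simp: S_def set_mult_def)
      then have "conj_by G w a = conj_by G w l \<otimes> conj_by G w x"
        using hom_mult[OF conj_by_hom[OF wc], of l x] Lsub Rc by auto
      moreover have "conj_by G w l \<in> L" by (rule normaliser_conj_closed[OF wL lx(1)])
      moreover have "conj_by G w x \<in> R" by (rule normaliser_conj_closed[OF wR lx(2)])
      ultimately show "conj_by G w a \<in> S" by (auto simp: S_def set_mult_def)
    qed
    have WS: "W \<subseteq> normaliser G S"
      using wS generate_subgroup_incl[OF _ normaliser_subgroup[OF Ssub]] unfolding W_def by simp
    have "M \<subseteq> normaliser G S"
    proof -
      have 1: "L \<subseteq> normaliser G S" "R \<subseteq> normaliser G S" using subgroup_subset_normaliser[OF S] LS RS by auto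
      have "V \<subseteq> normaliser G S"
        unfolding V_def by (rule set_mult_subset_subgroup[OF normaliser_subgroup[OF Ssub] 1(2) WS])
      then show ?thesis
        unfolding M_def by (rule set_mult_subset_subgroup[OF normaliser_subgroup[OF Ssub] 1(1)])
    qed
    then have SN: "S \<lhd> G\<lparr>carrier := M\<rparr>" by (rule normal_in_M[OF S SM])
    let ?M = "G\<lparr>carrier := M\<rparr>"
    interpret M: group ?M using M by (rule subgroup_imp_group)
    obtain E where E: "E \<lhd> ?M" "E \<subset> L" "finite (carrier (?M Mod E))"
      and chief: "\<And>D. D \<lhd> ?M Mod E \<Longrightarrow> D \<subseteq> (\<lambda>g. E #>\<^bsub>?M\<^esub> g) ` L
        \<Longrightarrow> D = {\<one>\<^bsub>?M Mod E\<^esub>} \<or> D = (\<lambda>g. E #>\<^bsub>?M\<^esub> g) ` L"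
      using M.exists_chief_quotient[OF LN N] by blast
    interpret E: normal E ?M by (rule E(1))
    define Q where "Q = ?M Mod E"
    define pi where "pi g = E #>\<^bsub>?M\<^esub> g" for g
    interpret pi: group_hom ?M Q pi using E.group_hom_FactGroup unfolding Q_def pi_def .
    have onto: "pi ` carrier ?M = carrier Q" unfolding pi_def Q_def by (simp add: carrier_FactGroup)
    define F where "F = pi ` L"
    have F: "F \<lhd> Q"
      unfolding F_def using normal.surj_hom_normal_subgroup[OF LN pi.group_hom_axioms onto] .
    have Fs: "subgroup F Q" using F by (rule normal_imp_subgroup)
    have Fsub: "F \<subseteq> carrier Q" using Fs by (rule subgroup.subset)
    have F1: "F \<noteq> {\<one>\<^bsub>Q\<^esub>}"
    proof
      assume eq: "F = {\<one>\<^bsub>Q\<^esub>}"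
      have "l \<in> E" if l: "l \<in> L" for l
      proof -
        have "pi l = E" using eq l by (auto simp: F_def Q_def)
        then show ?thesis using M.rcos_self[of l E] l LM E.subgroup_axioms by (auto simp: pi_def)
      qed
      then show False using E(2) by blast
    qed
    have finQ: "finite (carrier Q)" using E(3) by (simp add: Q_def)
    have chiefQ: "D = {\<one>\<^bsub>Q\<^esub>} \<or> D = F" if "D \<lhd> Q" "D \<subseteq> F" for D
      using chief[of D] that by (simp add: Q_def F_def pi_def)
    have pi_mult: "pi (a \<otimes> b) = pi a \<otimes>\<^bsub>Q\<^esub> pi b" if "a \<in> M" "b \<in> M" for a b
      using pi.hom_mult[of a b] that by simp
    have pi_inv: "pi (inv a) = inv\<^bsub>Q\<^esub> pi a" if "a \<in> M" for a
      using pi.hom_inv[of a] that m_inv_consistent[OF M that] by simp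
    have pi_closed: "pi a \<in> carrier Q" if "a \<in> M" for a using pi.hom_closed[of a] that by simp
    note Mcl = subgroup.m_closed[OF M] subgroup.m_inv_closed[OF M]
    have pi_conj: "pi (conj_by G a b) = conj_by Q (pi a) (pi b)" if "a \<in> M" "b \<in> M" for a b
      using that by (simp add: pi_mult pi_inv Mcl)
    have engelQ: "engel_on Q F (pi u)" if u: "u \<in> M" "engel_on G T u" for u
    proof -
      have "engel_on G L u" using u(2) LT by (auto simp: engel_on_def)
      then have "engel_on ?M L u" using engel_on_subgroup_iff[OF M u(1) LM] by simp
      then show ?thesis using pi.engel_on_image[of u L] u(1) LM by (simp add: F_def)
    qed
    have cent: "pi ` U \<subseteq> pi.H.centraliser F"
      if U: "subgroup U G" "U \<subseteq> M" "L <#> U = S" and eng: "\<And>u. u \<in> U \<Longrightarrow> engel_on G T u" for U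
    proof (rule pi.H.engel_subgroup_centralises_chief_factor[OF finQ F F1 chiefQ])
      show "subgroup (pi ` U) Q" using pi.subgroup_img_is_subgroup[OF subgroup_incl[OF U(1) M U(2)]] .
      have "F <#>\<^bsub>Q\<^esub> pi ` U = pi ` S"
      proof
        show "F <#>\<^bsub>Q\<^esub> pi ` U \<subseteq> pi ` S"
        proof
          fix q assume "q \<in> F <#>\<^bsub>Q\<^esub> pi ` U"
          then obtain l u where lu: "l \<in> L" "u \<in> U" "q = pi l \<otimes>\<^bsub>Q\<^esub> pi u" by (auto simp: set_mult_def F_def)
          then have "q = pi (l \<otimes> u)" using pi_mult[of l u] LM U(2) by auto
          moreover have "l \<otimes> u \<in> S" using lu U(3) unfolding set_mult_def by blast
          ultimately show "q \<in> pi ` S" by blast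
        qed
        show "pi ` S \<subseteq> F <#>\<^bsub>Q\<^esub> pi ` U"
        proof
          fix q assume "q \<in> pi ` S"
          then obtain l u where lu: "l \<in> L" "u \<in> U" "q = pi (l \<otimes> u)"
            unfolding U(3)[symmetric] by (auto simp: set_mult_def)
          then have "q = pi l \<otimes>\<^bsub>Q\<^esub> pi u" using pi_mult[of l u] LM U(2) by auto
          then show "q \<in> F <#>\<^bsub>Q\<^esub> pi ` U" using lu unfolding set_mult_def F_def by blast
        qed
      qed
      then show "F <#>\<^bsub>Q\<^esub> pi ` U \<lhd> Q"
        using normal.surj_hom_normal_subgroup[OF SN pi.group_hom_axioms onto] by simp
      show "engel_on Q F u" if u: "u \<in> pi ` U" for u
        using u engelQ eng U(2) by blast
    qed
    have RM: "R \<subseteq> M" using RV VM by blast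
    have wM: "w \<in> M" using wW WV VM by blast
    have centR: "pi ` R \<subseteq> pi.H.centraliser F"
      using engel R(2) by (intro cent[OF R(1) RM]) (auto simp: S_def)
    have xh_eq: "xh x = c x \<otimes> x" if "x \<in> R" for x
      using Rc[OF that] xhc by (simp add: c_def m_assoc)
    have xhS: "xh x \<in> S" if "x \<in> R" for x
      unfolding xh_eq[OF that] S_def set_mult_def using cL[OF that] that by blast
    have xh_img: "xh ` R = conj_by G (inv h) ` R" using hc by (simp add: xh_def image_def)
    have centXh: "pi ` xh ` R \<subseteq> pi.H.centraliser F"
    proof (rule cent)
      interpret f: group_hom G G "conj_by G (inv h)" using conj_by_hom[of "inv h"] hc by unfold_locales simp
      show "subgroup (xh ` R) G" unfolding xh_img by (rule f.subgroup_img_is_subgroup[OF R(1)])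
      show "xh ` R \<subseteq> M" using xhS SM by blast
      show "L <#> xh ` R = S"
      proof
        show "L <#> xh ` R \<subseteq> S" using LS xhS by (intro set_mult_subset_subgroup[OF S]) auto
        show "S \<subseteq> L <#> xh ` R"
        proof
          fix a assume "a \<in> S"
          then obtain l x where lx: "l \<in> L" "x \<in> R" "a = l \<otimes> x" by (auto simp: S_def set_mult_def)
          then have "a = (l \<otimes> inv (c x)) \<otimes> xh x"
            using Lsub Rc[of x] cc[of x] by (auto simp: xh_eq word_simps)
          moreover have "l \<otimes> inv (c x) \<in> L"
            using lx cL L by (simp add: subgroup.m_closed subgroup.m_inv_closed)
          ultimately show "a \<in> L <#> xh ` R" using lx(2) unfolding set_mult_def by blast
        qed
      qed
      show "engel_on G T u" if "u \<in> xh ` R" for u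
      proof -
        obtain x where x: "x \<in> R" "u = xh x" using \<open>u \<in> xh ` R\<close> by blast
        then show ?thesis using engel_on_conj[OF T h Rc[OF x(1)]] engel R(2) by (auto simp: xh_def)
      qed
    qed
    have CFs: "subgroup (pi.H.centraliser F) Q" by (rule pi.H.centraliser_subgroup[OF Fsub])
    have cM: "c x \<in> M" "xh x \<in> M" if "x \<in> R" for x using cL xhS LM SM that by auto
    define cb where "cb x = pi (c x)" for x
    have cbF: "cb x \<in> F" if "x \<in> R" for x using cL[OF that] by (auto simp: cb_def F_def)
    have gen: "F = generate Q (cb ` R)"
    proof -
      have "A \<subseteq> M" using cM by (auto simp: A_def)
      then have "generate Q (pi ` A) = pi ` generate ?M A" using pi.generate_img by simp
      also have "generate ?M A = L" using generate_consistent[OF \<open>A \<subseteq> M\<close> M] by (simp add: L_def)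
      finally show ?thesis by (simp add: F_def A_def cb_def image_image)
    qed
    have "cb x \<in> pi.H.centraliser F" if x: "x \<in> R" for x
    proof -
      have "cb x = pi (xh x) \<otimes>\<^bsub>Q\<^esub> inv\<^bsub>Q\<^esub> pi x"
        using cM x RM by (auto simp: cb_def c_def pi_mult pi_inv Mcl)
      moreover have "pi (xh x) \<in> pi.H.centraliser F" "pi x \<in> pi.H.centraliser F" using centXh centR x by auto
      ultimately show ?thesis using CFs by (simp add: subgroup.m_closed subgroup.m_inv_closed)
    qed
    \<comment> \<open>So \<open>F\<close> is abelian.\<close>
    then have FF: "F \<subseteq> pi.H.centraliser F"
      using pi.H.generate_subgroup_incl[OF _ CFs, of "cb ` R"] gen by auto
    \<comment> \<open>A fixed point \<open>e\<close> of \<open>w\<close> in \<open>F\<close> is centralised by the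
      images of \<open>L\<close>, \<open>R\<close> and \<open>w\<close>, hence it is central in
      \<open>Q\<close> and generates \<open>F\<close>.\<close>
    have w_cent: "conj_by Q (pi w) f = f" if f: "f \<in> F" for f
    proof -
      have "engel_on Q F (pi w)"
        using engelQ[OF wM] engel_on_conj[OF T h hc(2) engel[OF y(1)]] by (simp add: w_def xh_def)
      moreover have "conj_by Q (pi w) f \<in> F" if "f \<in> F" for f
        using normal.inv_op_closed2[OF F pi_closed[OF wM] that] .
      ultimately obtain e where e: "e \<in> F" "e \<noteq> \<one>\<^bsub>Q\<^esub>" "conj_by Q (pi w) e = e"
        using pi.H.engel_fixed_point[OF Fs F1 pi_closed[OF wM]] by blast
      have ec: "e \<in> carrier Q" using e Fsub by blast
      have Ce: "subgroup (pi.H.centraliser {e}) Q" using pi.H.centraliser_subgroup[of "{e}"] ec by simp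
      have "carrier Q \<subseteq> pi.H.centraliser {e}"
      proof
        fix q assume "q \<in> carrier Q"
        then obtain m where m: "m \<in> M" "q = pi m" using onto by auto
        obtain l v where lv: "l \<in> L" "v \<in> V" "m = l \<otimes> v" using m unfolding M_def set_mult_def by blast
        obtain x u where xu: "x \<in> R" "u \<in> W" "v = x \<otimes> u" using lv unfolding V_def set_mult_def by blast
        have "pi l \<in> pi.H.centraliser {e}" "pi x \<in> pi.H.centraliser {e}"
          using lv xu FF centR e(1) by (auto simp: F_def pi.H.centraliser_def)
        moreover have "pi u \<in> pi.H.centraliser {e}"
        proof -
          have "W \<subseteq> M" using WV VM by blast
          have "pi ` W = generate Q {pi w}"
            using pi.generate_img[of "{w}"] generate_consistent[of "{w}" M] wM M by (simp add: W_def)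
          moreover have "generate Q {pi w} \<subseteq> pi.H.centraliser {e}"
            using e(3) pi_closed[OF wM]
            by (intro pi.H.generate_subgroup_incl[OF _ Ce]) (simp add: pi.H.centraliser_def)
          ultimately show ?thesis using xu by blast
        qed
        moreover have "q = pi l \<otimes>\<^bsub>Q\<^esub> (pi x \<otimes>\<^bsub>Q\<^esub> pi u)"
          using m lv xu LM RM WV VM by (simp add: pi_mult Mcl subset_iff)
        ultimately show "q \<in> pi.H.centraliser {e}" using Ce by (simp add: subgroup.m_closed)
      qed
      then have "generate Q {e} \<lhd> Q"
        using ec by (intro pi.H.normal_generateI) (auto simp: pi.H.centraliser_def)
      moreover have "generate Q {e} \<subseteq> F" using pi.H.generate_subgroup_incl[OF _ Fs] e by simp
      moreover have "generate Q {e} \<noteq> {\<one>\<^bsub>Q\<^esub>}" using e(2) generate.incl[of e "{e}" Q] by auto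
      ultimately have "generate Q {e} = F" using chiefQ by blast
      moreover have "generate Q {e} \<subseteq> pi.H.centraliser {pi w}"
      proof (rule pi.H.generate_subgroup_incl[OF _ pi.H.centraliser_subgroup])
        have "pi w \<otimes>\<^bsub>Q\<^esub> e = e \<otimes>\<^bsub>Q\<^esub> pi w"
          using e(3) ec pi_closed[OF wM] by (metis pi.H.inv_solve_right pi.H.m_closed)
        then show "{e} \<subseteq> pi.H.centraliser {pi w}"
          using ec pi_closed[OF wM] by (simp add: pi.H.centraliser_def pi.H.m_assoc flip: \<open>pi w \<otimes>\<^bsub>Q\<^esub> e = e \<otimes>\<^bsub>Q\<^esub> pi w\<close>)
      qed (use pi_closed[OF wM] in simp)
      ultimately have "f \<in> pi.H.centraliser {pi w}" using f by blast
      then have fw: "conj_by Q f (pi w) = pi w" "f \<in> carrier Q" by (auto simp: pi.H.centraliser_def)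
      then have "f \<otimes>\<^bsub>Q\<^esub> pi w = pi w \<otimes>\<^bsub>Q\<^esub> f"
        using pi_closed[OF wM] by (metis pi.H.inv_solve_right pi.H.m_closed)
      then show ?thesis
        using fw pi_closed[OF wM] by (simp add: pi.H.m_assoc flip: \<open>f \<otimes>\<^bsub>Q\<^esub> pi w = pi w \<otimes>\<^bsub>Q\<^esub> f\<close>)
    qed
    \<comment> \<open>In general \<open>c (a b) = c a \<cdot> a (c b) a\<^sup>-\<close>, and \<open>R\<close> acts
      trivially on \<open>F\<close>.\<close>
    have cb_mult: "cb (a \<otimes> b) = cb a \<otimes>\<^bsub>Q\<^esub> cb b" if ab: "a \<in> R" "b \<in> R" for a b
    proof -
      have "c (a \<otimes> b) = c a \<otimes> conj_by G a (c b)"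
        using ab Rc hc by (simp add: c_def xh_def word_simps)
      then have "cb (a \<otimes> b) = cb a \<otimes>\<^bsub>Q\<^esub> conj_by Q (pi a) (cb b)"
        using cM ab RM pi_conj[of a "c b"] unfolding cb_def by (auto simp: pi_mult Mcl)
      moreover have "conj_by Q (pi a) (cb b) = cb b"
        using centR cbF[OF ab(2)] ab(1) by (auto simp: pi.H.centraliser_def)
      ultimately show ?thesis by simp
    qed
    have cb_y: "cb (conj_by G y a) = cb a" if a: "a \<in> R" for a
    proof -
      have "cb (conj_by G y a) = pi (conj_by G w (c a))" using w_c[OF a] by (simp add: cb_def)
      also have "\<dots> = conj_by Q (pi w) (cb a)" using pi_conj[OF wM cM(1)[OF a]] by (simp add: cb_def)
      also have "\<dots> = cb a" by (rule w_cent[OF cbF[OF a]])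
      finally show ?thesis .
    qed
    have cbc: "cb a \<in> carrier Q" if "a \<in> R" for a using cbF[OF that] Fsub by blast
    have cb1: "cb \<one> = \<one>\<^bsub>Q\<^esub>"
      using hc pi.hom_one by (simp add: cb_def c_def xh_def)
    have inv_cb: "cb (inv a) \<otimes>\<^bsub>Q\<^esub> cb a = \<one>\<^bsub>Q\<^esub>" if "a \<in> R" for a
      using cb_mult[of "inv a" a] that Rcl Rc cb1 by simp
    define R1 where "R1 = {x \<in> R. cb x = \<one>\<^bsub>Q\<^esub>}"
    have "subgroup R1 G"
    proof
      show "inv a \<in> R1" if "a \<in> R1" for a
        using that inv_cb[of a] cbc[of "inv a"] Rcl by (simp add: R1_def)
    qed (use Rc Rcl cb1 cb_mult in \<open>auto simp: R1_def\<close>)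
    moreover have "(\<lambda>x. inv x \<otimes> conj_by G y x) ` R \<subseteq> R1"
    proof
      fix r assume "r \<in> (\<lambda>x. inv x \<otimes> conj_by G y x) ` R"
      then obtain a where a: "a \<in> R" "r = inv a \<otimes> conj_by G y a" by blast
      have "cb r = cb (inv a) \<otimes>\<^bsub>Q\<^esub> cb a"
        unfolding a(2) using cb_mult[of "inv a" "conj_by G y a"] cb_y a Rcl y(2) by simp
      then show "r \<in> R1" using inv_cb a Rcl y(2) by (simp add: R1_def)
    qed
    ultimately have "R \<subseteq> R1" using generate_subgroup_incl comm by metis
    then have "cb ` R \<subseteq> {\<one>\<^bsub>Q\<^esub>}" by (auto simp: R1_def)
    then have "F \<subseteq> {\<one>\<^bsub>Q\<^esub>}"
      unfolding gen using pi.H.generate_subgroup_incl[OF _ pi.H.triv_subgroup] by blast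
    then show False using F1 subgroup.one_closed[OF Fs] by blast
  qed
  then have "c x = \<one>" using cL[OF x] by blast
  then have "c x \<otimes> x = x" using Rc[OF x] by simp
  then have "h \<otimes> (inv h \<otimes> x \<otimes> h) = h \<otimes> x" using Rc[OF x] hc by (simp add: c_def xh_def word_simps)
  then have "x \<otimes> h = h \<otimes> x" using Rc[OF x] hc by (simp add: word_simps)
  then show ?thesis using Rc[OF x] hc by (simp add: m_assoc)
qed

text \<open>
  Every \<open>h \<in> T\<close> has an Engel sequence with respect to \<open>y\<close> that ends in \<open>1\<close>; go back along it.
\<close>

lemma (in group) commutator_closed_engel_subgroup_centralises:
  assumes T: "subgroup T G" and lg: "locally_graded (G\<lparr>carrier := T\<rparr>)"
    and H: "subgroup H G" "finite H" "H \<subseteq> normaliser G T"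
    and engel: "\<And>x. x \<in> H \<Longrightarrow> engel_on G T x"
    and R: "subgroup R G" "R \<subseteq> H" and y: "y \<in> H" "\<And>x. x \<in> R \<Longrightarrow> conj_by G y x \<in> R"
    and comm: "generate G ((\<lambda>x. inv x \<otimes> conj_by G y x) ` R) = R"
  shows "R \<subseteq> centraliser T"
proof -
  note Tc = subgroup.mem_carrier[OF T] and Hc = subgroup.mem_carrier[OF H(1)]
  have "\<forall>x\<in>R. conj_by G x h = h" if "h \<in> T" "iter_comm G h n (conj_by G y) = \<one>" for h n
    using that
  proof (induction n arbitrary: h)
    case 0
    then show ?case using Hc R(2) by auto
  next
    case (Suc n)
    let ?k = "inv h \<otimes> conj_by G y h"
    have "conj_by G y h \<in> T" by (rule normaliser_conj_closed) (use Suc.prems y(1) H(3) in auto)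
    then have "?k \<in> T" using Suc.prems T by (simp add: subgroup.m_closed subgroup.m_inv_closed)
    moreover have "iter_comm G ?k n (conj_by G y) = \<one>" using Suc.prems(2) by (simp only: iter_comm_Suc_shift)
    ultimately have "\<forall>x\<in>R. conj_by G x ?k = ?k" by (rule Suc.IH)
    then show ?case
      by (intro ballI centralises_if_centralises_commutator[OF T lg H engel R y comm Suc.prems(1)]) auto
  qed
  moreover have "\<exists>n. iter_comm G h n (conj_by G y) = \<one>" if "h \<in> T" for h
    using engel[OF y(1)] that unfolding engel_on_def by blast
  ultimately show ?thesis using R(2) Hc unfolding centraliser_def by blast
qed

text \<open>
  Choose \<open>R\<close> minimal among the \<open>y\<close>-invariant subgroups of \<open>H\<close> that all sequences \<open>[g,\<^sub>n y]\<close> with \<open>g \<in> H\<close> enter. The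
  subgroup \<open>[R,y]\<close> has this property too, so \<open>R = [R,y]\<close>. Then \<open>R\<close> centralises \<open>T\<close>, and so \<open>R = 1\<close>.
\<close>

theorem (in group) faithful_engel_action_implies_engel:
  assumes T: "subgroup T G" and lg: "locally_graded (G\<lparr>carrier := T\<rparr>)"
    and H: "subgroup H G" "finite H" "H \<subseteq> normaliser G T"
    and engel: "\<And>x. x \<in> H \<Longrightarrow> engel_on G T x"
    and faithful: "H \<inter> centraliser T \<subseteq> {\<one>}"
    and y: "y \<in> H"
  shows "engel_on G H y"
proof -
  note Hc = subgroup.mem_carrier[OF H(1)] and Hcl = subgroup.m_closed[OF H(1)] subgroup.m_inv_closed[OF H(1)]
  define P where "P R \<longleftrightarrow> subgroup R G \<and> R \<subseteq> H \<and> (\<forall>x\<in>R. conj_by G y x \<in> R) \<and>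
    (\<forall>g\<in>H. \<exists>n. iter_comm G g n (conj_by G y) \<in> R)" for R
  have "iter_comm G g 0 (conj_by G y) \<in> H" if "g \<in> H" for g using that by simp
  then have "\<forall>g\<in>H. \<exists>n. iter_comm G g n (conj_by G y) \<in> H" by blast
  then have "P H" using H(1) y Hcl by (simp add: P_def)
  then obtain R where R: "P R" "\<And>R'. P R' \<Longrightarrow> card R \<le> card R'"
    using ex_has_least_nat[of P H card] by blast
  have Rs: "subgroup R G" "R \<subseteq> H" and yR: "\<And>x. x \<in> R \<Longrightarrow> conj_by G y x \<in> R"
    and into: "\<And>g. g \<in> H \<Longrightarrow> \<exists>n. iter_comm G g n (conj_by G y) \<in> R"
    using R(1) by (auto simp: P_def)
  note Rc = subgroup.mem_carrier[OF Rs(1)] and Rcl = subgroup.m_closed[OF Rs(1)] subgroup.m_inv_closed[OF Rs(1)]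
  have yc: "y \<in> carrier G" using y Hc by blast
  define B where "B = (\<lambda>x. inv x \<otimes> conj_by G y x) ` R"
  have BR: "B \<subseteq> R" using yR Rcl by (auto simp: B_def)
  have Bc: "B \<subseteq> carrier G" using BR Rc by blast
  define R' where "R' = generate G B"
  have R's: "subgroup R' G" unfolding R'_def by (rule generate_is_subgroup[OF Bc])
  have R'R: "R' \<subseteq> R" unfolding R'_def by (rule generate_subgroup_incl[OF BR Rs(1)])
  have "P R'"
    unfolding P_def
  proof (intro conjI ballI)
    fix x assume x: "x \<in> R'"
    interpret f: group_hom G G "conj_by G y" using conj_by_hom[OF yc] by unfold_locales
    have "conj_by G y ` B \<subseteq> B"
    proof
      fix b assume "b \<in> conj_by G y ` B"
      then obtain r where r: "r \<in> R" "b = conj_by G y (inv r \<otimes> conj_by G y r)" by (auto simp: B_def)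
      then have "b = inv (conj_by G y r) \<otimes> conj_by G y (conj_by G y r)"
        using Rc yc by (simp add: word_simps)
      then show "b \<in> B" using yR[OF r(1)] unfolding B_def by blast
    qed
    then have "conj_by G y ` R' \<subseteq> R'"
      unfolding R'_def using f.generate_img[OF Bc] mono_generate by metis
    then show "conj_by G y x \<in> R'" using x by blast
  next
    fix g assume "g \<in> H"
    then obtain n where n: "iter_comm G g n (conj_by G y) \<in> R" using into by blast
    then have "iter_comm G g (Suc n) (conj_by G y) \<in> B" unfolding B_def by simp
    then have "iter_comm G g (Suc n) (conj_by G y) \<in> R'" unfolding R'_def by (rule generate.incl)
    then show "\<exists>n. iter_comm G g n (conj_by G y) \<in> R'" by blast
  qed (use R's R'R Rs(2) in auto)
  then have "card R \<le> card R'" by (rule R(2))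
  moreover have "finite R" using Rs(2) H(2) finite_subset by blast
  ultimately have "R' = R" using R'R by (simp add: card_seteq)
  then have "R \<subseteq> centraliser T"
    by (intro commutator_closed_engel_subgroup_centralises[OF T lg H engel Rs y yR]) (auto simp: R'_def B_def)
  then have "R \<subseteq> {\<one>}" using faithful Rs(2) by blast
  then show ?thesis using into unfolding engel_on_def by blast
qed

section \<open>Automorphisms as conjugations of translations\<close>

lemma locally_graded_iso:
  assumes lg: "locally_graded G" and K: "group K" and f: "f \<in> iso G K"
  shows "locally_graded K"
  unfolding locally_graded_def
proof (intro conjI allI impI K)
  interpret G: group G using lg by (simp add: locally_graded_def)
  interpret K: group K by (rule K)
  interpret f: group_hom G K f using f by unfold_locales (simp add: iso_def)
  have bij: "inj_on f (carrier G)" "f ` carrier G = carrier K" using f by (auto simp: iso_def bij_betw_def)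
  fix B assume B: "B \<subseteq> carrier K \<and> finite B \<and> generate K B \<noteq> {\<one>\<^bsub>K\<^esub>}"
  obtain A where A: "A \<subseteq> carrier G" "finite A" "f ` A = B"
    using finite_subset_image[of B f "carrier G"] B bij(2) by metis
  have LB: "generate K B = f ` generate G A" using f.generate_img[OF A(1)] A(3) by simp
  let ?L = "generate G A"
  have "?L \<noteq> {\<one>\<^bsub>G\<^esub>}" using B LB by auto
  then obtain N where N: "N \<lhd> G\<lparr>carrier := ?L\<rparr>" "N \<noteq> ?L" "finite (rcosets\<^bsub>G\<lparr>carrier := ?L\<rparr>\<^esub> N)"
    using lg A unfolding locally_graded_def by blast
  have L: "subgroup ?L G" by (rule G.generate_is_subgroup[OF A(1)])
  have Lc: "?L \<subseteq> carrier G" using L by (rule subgroup.subset)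
  have NL: "N \<subseteq> ?L" using normal_imp_subgroup[OF N(1)] subgroup.subset by fastforce
  have fL: "subgroup (f ` ?L) K" by (rule f.subgroup_img_is_subgroup[OF L])
  interpret h: group_hom "G\<lparr>carrier := ?L\<rparr>" "K\<lparr>carrier := f ` ?L\<rparr>" f
    using G.subgroup_imp_group[OF L] K.subgroup_imp_group[OF fL] Lc
    by (intro group_hom.intro group_hom_axioms.intro) (auto simp: hom_def subset_iff)
  have "f ` N \<lhd> K\<lparr>carrier := generate K B\<rparr>"
    unfolding LB using normal.surj_hom_normal_subgroup[OF N(1) h.group_hom_axioms] by simp
  moreover have "f ` N \<noteq> generate K B"
    unfolding LB using N(2) NL Lc bij(1) by (metis inj_on_image_eq_iff subset_trans)
  moreover have "finite (rcosets\<^bsub>K\<lparr>carrier := generate K B\<rparr>\<^esub> (f ` N))"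
  proof -
    have "f ` N #>\<^bsub>K\<^esub> f l = f ` (N #>\<^bsub>G\<^esub> l)" if "l \<in> ?L" for l
      using that NL Lc unfolding r_coset_def by (auto simp: subset_iff image_iff)
    then have "rcosets\<^bsub>K\<lparr>carrier := generate K B\<rparr>\<^esub> (f ` N)
        \<subseteq> (\<lambda>C. f ` C) ` (rcosets\<^bsub>G\<lparr>carrier := ?L\<rparr>\<^esub> N)"
      unfolding LB RCOSETS_def by auto
    then show ?thesis using N(3) by (meson finite_imageI finite_subset)
  qed
  ultimately show "\<exists>N. N \<lhd> K\<lparr>carrier := generate K B\<rparr> \<and> N \<noteq> generate K B \<and>
      finite (rcosets\<^bsub>K\<lparr>carrier := generate K B\<rparr>\<^esub> N)" by blast
qed

definition translation :: "('a, 'b) monoid_scheme \<Rightarrow> 'a \<Rightarrow> 'a \<Rightarrow> 'a" where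
  "translation G g = (\<lambda>x\<in>carrier G. g \<otimes>\<^bsub>G\<^esub> x)"

context group
begin

lemma translation_in_Bij: "g \<in> carrier G \<Longrightarrow> translation G g \<in> Bij (carrier G)"
  unfolding Bij_def translation_def
  by (auto intro!: bij_betwI[of _ _ _ "\<lambda>x. inv g \<otimes> x"] simp: inv_mult_cancel)

lemma translation_hom: "translation G \<in> hom G (BijGroup (carrier G))"
proof (rule homI)
  fix g h assume gh: "g \<in> carrier G" "h \<in> carrier G"
  then show "translation G (g \<otimes> h) = translation G g \<otimes>\<^bsub>BijGroup (carrier G)\<^esub> translation G h"
    using translation_in_Bij
    by (auto simp: BijGroup_def compose_def fun_eq_iff) (auto simp: translation_def m_assoc)
qed (simp add: BijGroup_def translation_in_Bij)

lemma translation_inj: "inj_on (translation G) (carrier G)"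
  by (rule inj_onI) (metis one_closed r_one restrict_apply' translation_def)

text \<open>
  As an identity of permutations this is the homomorphism law \<open>x (g a) = (x g) (x a)\<close>.
\<close>

lemma conj_by_automorphism_translation:
  assumes x: "x \<in> auto G" and g: "g \<in> carrier G"
  shows "conj_by (BijGroup (carrier G)) x (translation G g) = translation G (x g)"
proof -
  let ?B = "BijGroup (carrier G)"
  interpret B: group ?B by (rule group_BijGroup)
  have xB: "x \<in> Bij (carrier G)" "x \<in> hom G G" using x by (auto simp: auto_def)
  have xg: "x g \<in> carrier G" using xB(2) g by (auto simp: hom_def)
  have "x \<otimes>\<^bsub>?B\<^esub> translation G g = translation G (x g) \<otimes>\<^bsub>?B\<^esub> x"
  proof -
    have "compose (carrier G) x (translation G g) = compose (carrier G) (translation G (x g)) x"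
      using g xB(2) by (auto simp: compose_def translation_def fun_eq_iff hom_def)
    then show ?thesis using xB(1) translation_in_Bij[OF g] translation_in_Bij[OF xg] by (simp add: BijGroup_def)
  qed
  moreover have "x \<in> carrier ?B" "translation G g \<in> carrier ?B" "translation G (x g) \<in> carrier ?B"
    using xB(1) translation_in_Bij g xg by (auto simp: BijGroup_def)
  ultimately show ?thesis by (simp add: B.m_assoc)
qed

end

theorem theoremB:
  fixes G :: "('a, 'b) monoid_scheme" and H :: "('a \<Rightarrow> 'a) set"
  assumes "locally_graded G"
    and "group_of_nil_automorphisms G H"
    and "finite H"
  shows "nilpotent_group ((AutoGroup G)\<lparr>carrier := H\<rparr>)"
proof -
  let ?B = "BijGroup (carrier G)"
  interpret G: group G using assms(1) by (simp add: locally_graded_def)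
  interpret B: group ?B by (rule group_BijGroup)
  interpret t: group_hom G ?B "translation G" using G.translation_hom by unfold_locales
  define T where "T = translation G ` carrier G"
  have T: "subgroup T ?B" unfolding T_def by (rule t.subgroup_img_is_subgroup[OF G.subgroup_self])
  have "translation G \<in> iso G (?B\<lparr>carrier := T\<rparr>)"
    using G.translation_inj t.hom_mult by (auto simp: iso_def hom_def T_def bij_betw_def)
  then have lg: "locally_graded (?B\<lparr>carrier := T\<rparr>)"
    using locally_graded_iso[OF assms(1)] B.subgroup_imp_group[OF T] by blast
  have HA: "subgroup H (AutoGroup G)" and nil: "\<And>x. x \<in> H \<Longrightarrow> nil_automorphism G x"
    using assms(2) by (auto simp: group_of_nil_automorphisms_def)
  have auto: "x \<in> auto G" if "x \<in> H" for x using nil[OF that] by (simp add: nil_automorphism_def)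
  have H: "subgroup H ?B"
    using B.incl_subgroup[OF G.subgroup_auto] HA unfolding AutoGroup_def by blast
  note Hc = subgroup.mem_carrier[OF H]
  have app: "x g \<in> carrier G" if "x \<in> H" "g \<in> carrier G" for x g
    using auto[OF that(1)] that(2) by (auto simp: auto_def hom_def)
  have conj: "conj_by ?B x (translation G g) = translation G (x g)" if "x \<in> H" "g \<in> carrier G" for x g
    by (rule G.conj_by_automorphism_translation[OF auto[OF that(1)] that(2)])
  have HT: "H \<subseteq> normaliser ?B T"
  proof
    fix x assume x: "x \<in> H"
    interpret K: group "?B\<lparr>carrier := H\<rparr>" using H by (rule B.subgroup_imp_group)
    show "x \<in> normaliser ?B T"
    proof (rule B.torsion_in_normaliser[OF Hc[OF x]])
      show "x [^]\<^bsub>?B\<^esub> card H = \<one>\<^bsub>?B\<^esub>"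
        using K.pow_order_eq_1[of x] x by (simp add: order_def nat_pow_def)
      show "card H > 0" using assms(3) x by (auto simp: card_gt_0_iff)
      show "T \<subseteq> carrier ?B" using T by (rule subgroup.subset)
      show "conj_by ?B x a \<in> T" if "a \<in> T" for a using that conj[OF x] app[OF x] by (auto simp: T_def)
    qed
  qed
  have engel: "engel_on ?B T x" if x: "x \<in> H" for x
  proof -
    have iter: "iter_comm G g n x \<in> carrier G \<and>
        iter_comm ?B (translation G g) n (conj_by ?B x) = translation G (iter_comm G g n x)"
      if g: "g \<in> carrier G" for g n
    proof (induction n)
      case (Suc n)
      then show ?case using conj[OF x] app[OF x] by simp
    qed (use g in simp)
    show ?thesis unfolding engel_on_def T_def
    proof clarify
      fix g assume g: "g \<in> carrier G"
      then obtain n where "iter_comm G g n x = \<one>\<^bsub>G\<^esub>" using nil[OF x] unfolding nil_automorphism_def by blast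
      then have "iter_comm ?B (translation G g) n (conj_by ?B x) = \<one>\<^bsub>?B\<^esub>" using iter[OF g, of n] by simp
      then show "\<exists>n. iter_comm ?B (translation G g) n (conj_by ?B x) = \<one>\<^bsub>?B\<^esub>" by blast
    qed
  qed
  have faithful: "H \<inter> B.centraliser T \<subseteq> {\<one>\<^bsub>?B\<^esub>}"
  proof
    fix x assume x: "x \<in> H \<inter> B.centraliser T"
    have "x g = g" if g: "g \<in> carrier G" for g
    proof -
      have "translation G (x g) = translation G g"
        using conj[of x g] x g by (auto simp: B.centraliser_def T_def)
      then show ?thesis using G.translation_inj app[of x g] x g by (auto dest: inj_onD)
    qed
    moreover have "x \<in> extensional (carrier G)" using auto[of x] x by (auto simp: auto_def Bij_def)
    ultimately have "x = (\<lambda>g\<in>carrier G. g)" by (intro extensionalityI[of _ "carrier G"]) auto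
    then show "x \<in> {\<one>\<^bsub>?B\<^esub>}" by (simp add: BijGroup_def)
  qed
  interpret K: group "?B\<lparr>carrier := H\<rparr>" using H by (rule B.subgroup_imp_group)
  have "engel_on (?B\<lparr>carrier := H\<rparr>) H y" if y: "y \<in> H" for y
    using B.faithful_engel_action_implies_engel[OF T lg H assms(3) HT engel faithful y]
      B.engel_on_subgroup_iff[OF H y order_refl] by blast
  then have "nilpotent_group (?B\<lparr>carrier := H\<rparr>)"
    by (intro K.finite_engel_group_is_nilpotent) (simp_all add: assms(3))
  then show ?thesis by (simp add: AutoGroup_def)
qed

end
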